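(* Let $G$ be a Lie group and let $d:G\times G\to\mathbb R$ be a complete metric on $G$ such that $\tau_d=\tau_G$. Let $X=\{x_1,\ldots,x_k\}\ni e$ be a finite subset of $G$ such that $H_X=\{e\}$, and let $d,d^1,d^2,\ldots$ be the sequence of induced Hausdorff metrics on $G$ associated with $X$ (for the action of $G$ on itself by left multiplication). Suppose that there exists an intrinsic right invariant metric $\mathbf d$ on $G$ such that $d\le\mathbf d$. Then the sequence of induced Hausdorff metrics converges pointwise to a complete and intrinsic metric $d^\infty$ on $G$.
   Context: Notation. "Metric" means distance function; an extended metric may take the value $\infty$. $\tau_\rho$ is the topology induced by $\rho$ and $\tau_G$ is the manifold topology of $G$; $e$ is the identity. $\rho$ is right invariant if $\rho(x\sigma,y\sigma)=\rho(x,y)$ for all $x,y,\sigma\in G$. Lengths and intrinsic metrics. For a path $\gamma:[a,b]\to M$ in an (extended) metric space $(M,\rho)$, $\ell_\rho(\gamma)=\sup\sum_i\rho(\gamma(t_i),\gamma(t_{i-1}))$ over all partitions of $[a,b]$. The intrinsic (extended) metric induced by $\rho$ is $\hat\rho(x,y)=\inf_\gamma\ell_\rho(\gamma)$ over all continuous paths in $(M,\rho)$ connecting $x$ and $y$ ($\inf\emptyset=\infty$). $\rho$ is intrinsic if $\hat\rho=\rho$. Sequence of induced Hausdorff metrics. For a finite $X\subset G$ put $gX=\{gx:x\in X\}$ and $H_X=\{g\in G: gX=X\}$. For an (extended) metric $\rho$ on $G$, let $\rho_H(A,B)=\max\{\max_{a\in A}\min_{b\in B}\rho(a,b),\max_{b\in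 B}\min_{a\in A}\rho(a,b)\}$ for finite nonempty $A,B$. If $H_X=\{e\}$, then $\rho_X(g,h):=\rho_H(gX,hX)$ is an (extended) metric on $G$. The sequence of induced Hausdorff metrics is $d^0=d$, $d^{i}=\widehat{(d^{i-1})_X}$ for $i\ge1$. *)

theory Defs
  imports "HOL-Analysis.Analysis" "HOL-Algebra.Coset"
begin

section \<open>Smooth manifolds and Lie groups\<close>

text \<open>
  Coordinates take values in \<^const>\<open>Euclidean_space\<close>, i.e. the functions \<open>nat \<Rightarrow> real\<close> vanishing
  from index \<open>n\<close> on. Thus the dimension is an ordinary natural number and may be \<open>0\<close>.
\<close>

definition partial_deriv :: "nat \<Rightarrow> ((nat \<Rightarrow> real) \<Rightarrow> real) \<Rightarrow> (nat \<Rightarrow> real) \<Rightarrow> real"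
  where "partial_deriv i f x = deriv (\<lambda>t. f (x(i := t))) (x i)"

text \<open>
  \<open>C_diff n k S f\<close>: the real function \<open>f\<close> is of class \<open>C^k\<close> on \<open>S\<close>, where \<open>S\<close> is meant to be an open
  subset of \<open>\<real>\<^sup>n\<close>; the values of \<open>f\<close> outside \<open>S\<close> are then irrelevant.
\<close>

primrec C_diff :: "nat \<Rightarrow> nat \<Rightarrow> (nat \<Rightarrow> real) set \<Rightarrow> ((nat \<Rightarrow> real) \<Rightarrow> real) \<Rightarrow> bool" where
  "C_diff n 0 S f \<longleftrightarrow> continuous_map (subtopology (Euclidean_space n) S) euclideanreal f"
| "C_diff n (Suc k) S f \<longleftrightarrow>
     continuous_map (subtopology (Euclidean_space n) S) euclideanreal f \<and>
     (\<forall>i<n. (\<forall>x\<in>S. (\<lambda>t. f (x(i := t))) differentiable at (x i)) \<and> C_diff n k S (partial_deriv i f))"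

definition smooth_between ::
  "nat \<Rightarrow> nat \<Rightarrow> (nat \<Rightarrow> real) set \<Rightarrow> ((nat \<Rightarrow> real) \<Rightarrow> (nat \<Rightarrow> real)) \<Rightarrow> bool"
  where "smooth_between n m S F \<longleftrightarrow> (\<forall>j<m. \<forall>k. C_diff n k S (\<lambda>z. F z j))"

type_synonym 'a chart = "'a set \<times> ('a \<Rightarrow> nat \<Rightarrow> real)"

definition is_chart :: "'a topology \<Rightarrow> nat \<Rightarrow> 'a chart \<Rightarrow> bool"
  where "is_chart T n = (\<lambda>(U, \<phi>).
    openin T U \<and> openin (Euclidean_space n) (\<phi> ` U) \<and>
    homeomorphic_map (subtopology T U) (subtopology (Euclidean_space n) (\<phi> ` U)) \<phi>)"

definition smooth_atlas :: "'a topology \<Rightarrow> nat \<Rightarrow> 'a chart set \<Rightarrow> bool"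
  where "smooth_atlas T n A \<longleftrightarrow>
    (\<forall>c\<in>A. is_chart T n c) \<and> (\<Union>(U, \<phi>)\<in>A. U) = topspace T \<and>
    (\<forall>(U, \<phi>)\<in>A. \<forall>(V, \<psi>)\<in>A. smooth_between n n (\<phi> ` (U \<inter> V)) (\<psi> \<circ> inv_into U \<phi>))"

definition smooth_manifold :: "'a topology \<Rightarrow> nat \<Rightarrow> 'a chart set \<Rightarrow> bool"
  where "smooth_manifold T n A \<longleftrightarrow>
    Hausdorff_space T \<and> second_countable T \<and> smooth_atlas T n A"

definition smooth_map ::
  "'a topology \<Rightarrow> nat \<Rightarrow> 'a chart set \<Rightarrow> 'b topology \<Rightarrow> nat \<Rightarrow> 'b chart set \<Rightarrow> ('a \<Rightarrow> 'b) \<Rightarrow> bool"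
  where "smooth_map T n A T' m B f \<longleftrightarrow> continuous_map T T' f \<and>
    (\<forall>(U, \<phi>)\<in>A. \<forall>(V, \<psi>)\<in>B. smooth_between n m (\<phi> ` (U \<inter> f -` V)) (\<psi> \<circ> f \<circ> inv_into U \<phi>))"

text \<open>The product of a chart into \<open>\<real>\<^sup>n\<close> and a chart into \<open>\<real>\<^sup>m\<close> lists the \<open>n\<close> coordinates of the
  first before the \<open>m\<close> coordinates of the second.\<close>

definition prod_atlas :: "nat \<Rightarrow> 'a chart set \<Rightarrow> 'b chart set \<Rightarrow> ('a \<times> 'b) chart set"
  where "prod_atlas n A B =
    {(U \<times> V, \<lambda>(x, y) i. if i < n then \<phi> x i else \<psi> y (i - n)) | U \<phi> V \<psi>. (U, \<phi>) \<in> A \<and> (V, \<psi>) \<in> B}"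

definition lie_group :: "('a, 'b) monoid_scheme \<Rightarrow> 'a topology \<Rightarrow> nat \<Rightarrow> 'a chart set \<Rightarrow> bool"
  where "lie_group G T n A \<longleftrightarrow>
    group G \<and> topspace T = carrier G \<and> smooth_manifold T n A \<and>
    smooth_map (prod_topology T T) (n + n) (prod_atlas n A A) T n A (\<lambda>(x, y). x \<otimes>\<^bsub>G\<^esub> y) \<and>
    smooth_map T n A T n A (m_inv G)"

section \<open>Extended metrics and induced intrinsic metrics\<close>

text \<open>Extended metrics on \<open>M\<close> are represented by functions into \<^typ>\<open>ennreal\<close>, whose values outside
  \<open>M\<close> are irrelevant.\<close>

definition ext_mtopology :: "'a set \<Rightarrow> ('a \<Rightarrow> 'a \<Rightarrow> ennreal) \<Rightarrow> 'a topology"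
  where "ext_mtopology M \<rho> =
    topology (\<lambda>U. U \<subseteq> M \<and> (\<forall>x\<in>U. \<exists>r>0. \<forall>y\<in>M. \<rho> x y < r \<longrightarrow> y \<in> U))"

lemma openin_ext_mtopology:
  "openin (ext_mtopology M \<rho>) U \<longleftrightarrow> U \<subseteq> M \<and> (\<forall>x\<in>U. \<exists>r>0. \<forall>y\<in>M. \<rho> x y < r \<longrightarrow> y \<in> U)"
proof -
  let ?P = "\<lambda>U. U \<subseteq> M \<and> (\<forall>x\<in>U. \<exists>r>0. \<forall>y\<in>M. \<rho> x y < r \<longrightarrow> y \<in> U)"
  have "istopology ?P"
    unfolding istopology_def
  proof (intro conjI allI impI)
    fix S T assume S: "?P S" and T: "?P T"
    show "S \<inter> T \<subseteq> M" using S by blast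
    show "\<forall>x\<in>S \<inter> T. \<exists>r>0. \<forall>y\<in>M. \<rho> x y < r \<longrightarrow> y \<in> S \<inter> T"
    proof
      fix x assume "x \<in> S \<inter> T"
      then obtain r s where "r > 0" "\<forall>y\<in>M. \<rho> x y < r \<longrightarrow> y \<in> S"
        and "s > 0" "\<forall>y\<in>M. \<rho> x y < s \<longrightarrow> y \<in> T"
        using S T by blast
      then show "\<exists>r>0. \<forall>y\<in>M. \<rho> x y < r \<longrightarrow> y \<in> S \<inter> T"
        by (intro exI[of _ "min r s"]) auto
    qed
  next
    fix \<K> assume "\<forall>K\<in>\<K>. ?P K"
    then show "\<Union>\<K> \<subseteq> M" "\<forall>x\<in>\<Union>\<K>. \<exists>r>0. \<forall>y\<in>M. \<rho> x y < r \<longrightarrow> y \<in> \<Union>\<K>"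
      by (blast, meson UnionE UnionI)
  qed
  then show ?thesis
    by (simp add: ext_mtopology_def topology_inverse')
qed

lemma (in Metric_space) ext_mtopology_ennreal:
  "ext_mtopology M (\<lambda>x y. ennreal (d x y)) = mtopology"
proof (rule topology_eq[THEN iffD2], intro allI)
  fix U
  have "(\<exists>r>0. \<forall>y\<in>M. ennreal (d x y) < r \<longrightarrow> y \<in> U) \<longleftrightarrow> (\<exists>r>0. mball x r \<subseteq> U)"
    if "x \<in> M" for x
  proof
    assume "\<exists>r>0. \<forall>y\<in>M. ennreal (d x y) < r \<longrightarrow> y \<in> U"
    then obtain r where r: "r > 0" "\<forall>y\<in>M. ennreal (d x y) < r \<longrightarrow> y \<in> U" by blast
    obtain e where e: "e > 0" "ennreal e \<le> r"
    proof (cases r)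
      case (real q)
      then show ?thesis using r(1) that[of q] by auto
    next
      case top
      then show ?thesis using that[of 1] by auto
    qed
    have "mball x e \<subseteq> U"
    proof
      fix y assume "y \<in> mball x e"
      then have "y \<in> M" "d x y < e" by auto
      then have "ennreal (d x y) < r"
        using e by (meson ennreal_lessI order_less_le_trans)
      with r \<open>y \<in> M\<close> show "y \<in> U" by blast
    qed
    with e show "\<exists>r>0. mball x r \<subseteq> U" by blast
  next
    assume "\<exists>r>0. mball x r \<subseteq> U"
    then obtain r where "r > 0" "mball x r \<subseteq> U" by blast
    then show "\<exists>r>0. \<forall>y\<in>M. ennreal (d x y) < r \<longrightarrow> y \<in> U"
      using that by (intro exI[of _ "ennreal r"]) (auto simp: ennreal_less_iff)
  qed
  then show "openin (ext_mtopology M (\<lambda>x y. ennreal (d x y))) U \<longleftrightarrow> openin mtopology U"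
    unfolding openin_ext_mtopology openin_mtopology by blast
qed

definition path_len :: "('a \<Rightarrow> 'a \<Rightarrow> ennreal) \<Rightarrow> real \<Rightarrow> real \<Rightarrow> (real \<Rightarrow> 'a) \<Rightarrow> ennreal"
  where "path_len \<rho> a b \<gamma> =
    Sup {\<Sum>i<N. \<rho> (\<gamma> (t (Suc i))) (\<gamma> (t i)) | N t.
           t 0 = a \<and> t N = b \<and> (\<forall>i<N. t i \<le> t (Suc i))}"

definition induced_intrinsic :: "'a set \<Rightarrow> ('a \<Rightarrow> 'a \<Rightarrow> ennreal) \<Rightarrow> 'a \<Rightarrow> 'a \<Rightarrow> ennreal"
  where "induced_intrinsic M \<rho> x y =
    Inf {path_len \<rho> a b \<gamma> | a b \<gamma>. a \<le> b \<and>
           continuous_map (top_of_set {a..b}) (ext_mtopology M \<rho>) \<gamma> \<and> \<gamma> a = x \<and> \<gamma> b = y}"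

definition is_intrinsic :: "'a set \<Rightarrow> ('a \<Rightarrow> 'a \<Rightarrow> ennreal) \<Rightarrow> bool"
  where "is_intrinsic M \<rho> \<longleftrightarrow> (\<forall>x\<in>M. \<forall>y\<in>M. induced_intrinsic M \<rho> x y = \<rho> x y)"

section \<open>Induced Hausdorff metrics\<close>

definition hausdorff_fin :: "('a \<Rightarrow> 'a \<Rightarrow> ennreal) \<Rightarrow> 'a set \<Rightarrow> 'a set \<Rightarrow> ennreal"
  where "hausdorff_fin \<rho> A B =
    max (Max ((\<lambda>a. Min ((\<lambda>b. \<rho> a b) ` B)) ` A)) (Max ((\<lambda>b. Min ((\<lambda>a. \<rho> a b) ` A)) ` B))"

definition set_stabilizer :: "('a, 'b) monoid_scheme \<Rightarrow> 'a set \<Rightarrow> 'a set"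
  where "set_stabilizer G X = {g \<in> carrier G. g <#\<^bsub>G\<^esub> X = X}"

definition hausdorff_orbit ::
  "('a, 'b) monoid_scheme \<Rightarrow> 'a set \<Rightarrow> ('a \<Rightarrow> 'a \<Rightarrow> ennreal) \<Rightarrow> 'a \<Rightarrow> 'a \<Rightarrow> ennreal"
  where "hausdorff_orbit G X \<rho> g h = hausdorff_fin \<rho> (g <#\<^bsub>G\<^esub> X) (h <#\<^bsub>G\<^esub> X)"

primrec hausdorff_seq ::
  "('a, 'b) monoid_scheme \<Rightarrow> 'a set \<Rightarrow> ('a \<Rightarrow> 'a \<Rightarrow> ennreal) \<Rightarrow> nat \<Rightarrow> 'a \<Rightarrow> 'a \<Rightarrow> ennreal" where
  "hausdorff_seq G X \<rho> 0 = \<rho>"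
| "hausdorff_seq G X \<rho> (Suc i) =
     induced_intrinsic (carrier G) (hausdorff_orbit G X (hausdorff_seq G X \<rho> i))"

definition right_invariant :: "('a, 'b) monoid_scheme \<Rightarrow> ('a \<Rightarrow> 'a \<Rightarrow> real) \<Rightarrow> bool"
  where "right_invariant G \<rho> \<longleftrightarrow>
    (\<forall>x\<in>carrier G. \<forall>y\<in>carrier G. \<forall>\<sigma>\<in>carrier G. \<rho> (x \<otimes>\<^bsub>G\<^esub> \<sigma>) (y \<otimes>\<^bsub>G\<^esub> \<sigma>) = \<rho> x y)"

end

theory Submission
  imports Defs
begin

text \<open>
  Call a curve short for an extended metric if it is 1-Lipschitz. Parametrizing by arc length shows that
  the intrinsic metric induced by \<open>\<sigma>\<close> is the infimum of the \<open>L\<close> such that a \<open>\<sigma>\<close>-short curve runs from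
  \<open>x\<close> at time \<open>0\<close> to \<open>y\<close> at time \<open>L\<close>. If \<open>\<rho> \<ge> d\<close>, then nearby points \<open>g\<close>, \<open>h\<close> have
  \<open>\<rho> (g x) (h x) \<le> \<rho>\<^sub>X g h\<close> for all \<open>x \<in> X\<close>, because \<open>d\<close> separates the points of \<open>g X\<close>. Hence a curve
  \<open>c\<close> is short for \<open>\<rho>\<^sub>X\<close> iff all \<open>c x\<close> with \<open>x \<in> X\<close> are short for \<open>\<rho>\<close>, and short for \<open>d\<^sup>i\<close> iff \<open>c w\<close>
  is short for \<open>d\<close> for every product \<open>w\<close> of \<open>i\<close> elements of \<open>X\<close>.

  The limit is the intrinsic metric whose short curves are those \<open>c\<close> for which \<open>c w\<close> is \<open>d\<close>-short for all
  products \<open>w\<close>. It is finite because curves that are short for the right invariant intrinsic metric have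
  this property. As in the Hopf-Rinow theorem, the \<open>d\<close>-short curves issuing from a point reach only
  a relatively compact set in bounded time, so that Tychonoff's theorem yields limits of such curves; this
  gives both the convergence and the completeness. No comparison of the topologies of \<open>d\<^sup>i\<close> with that of
  \<open>G\<close> is needed.
\<close>

section \<open>Short curves and induced intrinsic metrics\<close>

text \<open>Positivity at distinct points is recovered at the very end from a lower bound by
  \<open>d\<close>, so the intermediate functions are handled as extended pseudometrics.\<close>

definition ext_pseudometric_on :: "'a set \<Rightarrow> ('a \<Rightarrow> 'a \<Rightarrow> ennreal) \<Rightarrow> bool"
  where "ext_pseudometric_on M \<sigma> \<longleftrightarrow>
    (\<forall>x\<in>M. \<sigma> x x = 0) \<and> (\<forall>x\<in>M. \<forall>y\<in>M. \<sigma> x y = \<sigma> y x) \<and>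
    (\<forall>x\<in>M. \<forall>y\<in>M. \<forall>z\<in>M. \<sigma> x z \<le> \<sigma> x y + \<sigma> y z)"

text \<open>Curves live on the whole real line, so that reversal, shift and concatenation raise no
  question of domains; a curve on a compact interval is extended by constants.\<close>

definition short_curve :: "'a set \<Rightarrow> ('a \<Rightarrow> 'a \<Rightarrow> ennreal) \<Rightarrow> (real \<Rightarrow> 'a) \<Rightarrow> bool"
  where "short_curve M \<sigma> c \<longleftrightarrow>
    (\<forall>s. c s \<in> M) \<and> (\<forall>s t. \<sigma> (c s) (c t) \<le> ennreal \<bar>s - t\<bar>)"

lemma ext_pseudometric_onI:
  assumes "\<And>x. x \<in> M \<Longrightarrow> \<sigma> x x = 0"
    and "\<And>x y. x \<in> M \<Longrightarrow> y \<in> M \<Longrightarrow> \<sigma> x y = \<sigma> y x"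
    and "\<And>x y z. x \<in> M \<Longrightarrow> y \<in> M \<Longrightarrow> z \<in> M \<Longrightarrow> \<sigma> x z \<le> \<sigma> x y + \<sigma> y z"
  shows "ext_pseudometric_on M \<sigma>"
  using assms by (simp add: ext_pseudometric_on_def)

lemma ext_pseudometric_onD:
  assumes "ext_pseudometric_on M \<sigma>"
  shows "\<And>x. x \<in> M \<Longrightarrow> \<sigma> x x = 0"
    and "\<And>x y. x \<in> M \<Longrightarrow> y \<in> M \<Longrightarrow> \<sigma> x y = \<sigma> y x"
    and "\<And>x y z. x \<in> M \<Longrightarrow> y \<in> M \<Longrightarrow> z \<in> M \<Longrightarrow> \<sigma> x z \<le> \<sigma> x y + \<sigma> y z"
  using assms by (simp_all add: ext_pseudometric_on_def)

lemma (in Metric_space) ext_pseudometric_on_ennreal: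
  "ext_pseudometric_on M (\<lambda>x y. ennreal (d x y))"
  by (rule ext_pseudometric_onI)
    (simp_all add: commute triangle flip: ennreal_plus)

lemma short_curveI:
  assumes "\<And>s. c s \<in> M" and "\<And>s t. \<sigma> (c s) (c t) \<le> ennreal \<bar>s - t\<bar>"
  shows "short_curve M \<sigma> c"
  using assms by (simp add: short_curve_def)

lemma short_curve_lessI:
  assumes ps: "ext_pseudometric_on M \<sigma>" and M: "\<And>s. c s \<in> M"
    and le: "\<And>s t. s < t \<Longrightarrow> \<sigma> (c s) (c t) \<le> ennreal (t - s)"
  shows "short_curve M \<sigma> c"
proof (rule short_curveI[OF M])
  fix s t :: real
  show "\<sigma> (c s) (c t) \<le> ennreal \<bar>s - t\<bar>"
    using le[of s t] le[of t s] ext_pseudometric_onD(1)[OF ps M, of t]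
      ext_pseudometric_onD(2)[OF ps M M, of s t]
    by (cases s t rule: linorder_cases) auto
qed

text \<open>The form in which two infima over curves are compared: \<open>f < ennreal L\<close>
  supplies a curve of duration \<open>L\<close>, which then bounds \<open>g\<close>.\<close>

lemma ennreal_le_of_less_real:
  fixes f g :: ennreal
  assumes "\<And>L. L > 0 \<Longrightarrow> f < ennreal L \<Longrightarrow> g \<le> ennreal L"
  shows "g \<le> f"
proof (rule dense_ge)
  fix y assume "f < y"
  show "g \<le> y"
  proof (cases y)
    case (real r)
    then have "r > 0"
      using \<open>f < y\<close> by (cases "r = 0") auto
    then show ?thesis using assms \<open>f < y\<close> real by blast
  qed simp
qed

section \<open>Topology of extended metrics\<close>

lemma topspace_ext_mtopology [simp]: "topspace (ext_mtopology M \<sigma>) = M"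
proof -
  have "openin (ext_mtopology M \<sigma>) M"
    unfolding openin_ext_mtopology by (auto intro: exI[of _ 1])
  moreover have "topspace (ext_mtopology M \<sigma>) \<subseteq> M"
    using openin_topspace openin_ext_mtopology by metis
  ultimately show ?thesis
    by (simp add: openin_subset subset_antisym)
qed

lemma openin_ext_ball:
  assumes "ext_pseudometric_on M \<sigma>" "x \<in> M"
  shows "openin (ext_mtopology M \<sigma>) {y \<in> M. \<sigma> x y < e}"
  unfolding openin_ext_mtopology
proof (intro conjI ballI)
  fix y assume "y \<in> {y \<in> M. \<sigma> x y < e}"
  then have y: "y \<in> M" "\<sigma> x y < e" by auto
  have "\<sigma> x z < e" if "z \<in> M" "\<sigma> y z < e - \<sigma> x y" for z
  proof -
    have "\<sigma> x z \<le> \<sigma> y z + \<sigma> x y"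
      using ext_pseudometric_onD(3)[OF assms(1,2) y(1) that(1)] by (simp add: add.commute)
    also have "\<dots> < e"
      using that(2) y(2)
      by (subst (asm) less_diff_eq_ennreal) (auto intro: order_less_le_trans[OF _ top_greatest])
    finally show ?thesis .
  qed
  moreover have "e - \<sigma> x y > 0"
    using y(2) by (rule diff_gr0_ennreal)
  ultimately show "\<exists>r>0. \<forall>z\<in>M. \<sigma> y z < r \<longrightarrow> z \<in> {y \<in> M. \<sigma> x y < e}"
    by blast
qed auto

lemma continuous_ext_mtopologyD:
  fixes u :: real
  assumes ps: "ext_pseudometric_on M \<sigma>"
    and cont: "continuous_map (top_of_set {a..b}) (ext_mtopology M \<sigma>) \<gamma>"
    and u: "u \<in> {a..b}" and e: "e > 0"
  obtains \<delta> where "\<delta> > 0" "\<And>v. v \<in> {a..b} \<Longrightarrow> \<bar>v - u\<bar> < \<delta> \<Longrightarrow> \<sigma> (\<gamma> u) (\<gamma> v) < e"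
proof -
  have M: "\<gamma> v \<in> M" if "v \<in> {a..b}" for v
    using continuous_map_image_subset_topspace[OF cont] that by auto
  have "openin (top_of_set {a..b}) {v \<in> {a..b}. \<gamma> v \<in> {y \<in> M. \<sigma> (\<gamma> u) y < e}}"
    using openin_continuous_map_preimage[OF cont openin_ext_ball[OF ps M[OF u], of e]] by simp
  moreover have "u \<in> {v \<in> {a..b}. \<gamma> v \<in> {y \<in> M. \<sigma> (\<gamma> u) y < e}}"
    using u M e ext_pseudometric_onD(1)[OF ps M[OF u]] by simp
  ultimately obtain \<delta> where "\<delta> > 0"
    "\<forall>v\<in>{a..b}. dist v u < \<delta> \<longrightarrow> v \<in> {v \<in> {a..b}. \<gamma> v \<in> {y \<in> M. \<sigma> (\<gamma> u) y < e}}"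
    unfolding openin_euclidean_subtopology_iff by meson
  then show ?thesis
    using that[of \<delta>] by (auto simp: dist_real_def)
qed

section \<open>Arc length parametrization\<close>

text \<open>A partition of [a,u] followed by \<open>v\<close> is a partition of [a,v]. Hence arc
  length grows along a curve at least as fast as distance.\<close>

lemma path_len_add_step:
  assumes "a \<le> u" "u \<le> v"
  shows "path_len \<sigma> a u \<gamma> + \<sigma> (\<gamma> v) (\<gamma> u) \<le> path_len \<sigma> a v \<gamma>"
proof -
  let ?A = "\<lambda>u. {\<Sum>i<N. \<sigma> (\<gamma> (t (Suc i))) (\<gamma> (t i)) | N t.
           t 0 = a \<and> t N = u \<and> (\<forall>i<N. t i \<le> t (Suc i))}"
  have step: "p + \<sigma> (\<gamma> v) (\<gamma> u) \<le> path_len \<sigma> a v \<gamma>" if p_mem: "p \<in> ?A u" for p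
  proof -
    obtain N t where t: "t 0 = a" "t N = u" "\<forall>i<N. t i \<le> t (Suc i)"
      and p: "p = (\<Sum>i<N. \<sigma> (\<gamma> (t (Suc i))) (\<gamma> (t i)))"
      using p_mem by blast
    define t' where "t' = t(Suc N := v)"
    have "p + \<sigma> (\<gamma> v) (\<gamma> u) = (\<Sum>i<Suc N. \<sigma> (\<gamma> (t' (Suc i))) (\<gamma> (t' i)))"
      by (simp add: p t'_def t(2))
    moreover have "t' 0 = a" "t' (Suc N) = v" "\<forall>i<Suc N. t' i \<le> t' (Suc i)"
      using t assms by (auto simp: t'_def less_Suc_eq)
    ultimately have "p + \<sigma> (\<gamma> v) (\<gamma> u) \<in> ?A v"
      by blast
    then show ?thesis
      unfolding path_len_def by (rule Sup_upper)
  qed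
  \<comment> \<open>The partition with one step shows that the added distance is itself bounded by
    the length up to \<open>v\<close>, which is what allows the subtraction in
    \<open>ennreal\<close> below to be undone.\<close>
  have ne: "\<sigma> (\<gamma> u) (\<gamma> a) \<in> ?A u"
    using assms by (intro CollectI exI[of _ 1] exI[of _ "\<lambda>i. if i = 0 then a else u"]) auto
  have k: "\<sigma> (\<gamma> v) (\<gamma> u) \<le> path_len \<sigma> a v \<gamma>"
    using order_trans[OF add_increasing[OF zero_le order_refl] step[OF ne]] .
  have "path_len \<sigma> a u \<gamma> \<le> path_len \<sigma> a v \<gamma> - \<sigma> (\<gamma> v) (\<gamma> u)"
    unfolding path_len_def[of \<sigma> a u]
    by (rule Sup_least) (use step in \<open>simp add: ennreal_le_minus_iff\<close>)
  from add_right_mono[OF this, of "\<sigma> (\<gamma> v) (\<gamma> u)"] show ?thesis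
    by (simp only: diff_add_cancel_ennreal[OF k])
qed

text \<open>Arc length \<open>l\<close> can be constant on intervals, so it is inverted by suprema:
  \<open>U s\<close> is the last parameter up to which the length is at most \<open>s\<close>. The
  curve \<open>\<gamma> (U s)\<close> has reached \<open>b\<close> by time \<open>L\<close>, because
  the total length is below \<open>L\<close>.\<close>

lemma induced_intrinsic_less_imp_short_curve:
  assumes ps: "ext_pseudometric_on M \<sigma>" and less: "induced_intrinsic M \<sigma> x y < ennreal L"
  shows "\<exists>c. short_curve M \<sigma> c \<and> c 0 = x \<and> c L = y"
proof -
  obtain a b \<gamma> where ab: "a \<le> b"
    and cont: "continuous_map (top_of_set {a..b}) (ext_mtopology M \<sigma>) \<gamma>"
    and xy: "\<gamma> a = x" "\<gamma> b = y" and len: "path_len \<sigma> a b \<gamma> < ennreal L"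
    using less unfolding induced_intrinsic_def Inf_less_iff by auto
  have L: "L > 0"
    using len by (metis ennreal_neg not_less_zero not_le_imp_less)
  have M: "\<gamma> v \<in> M" if "v \<in> {a..b}" for v
    using continuous_map_image_subset_topspace[OF cont] that by auto
  define l where "l u = path_len \<sigma> a u \<gamma>" for u
  \<comment> \<open>Since \<open>ennreal\<close> sends negative numbers to 0, the condition
    \<open>0 < s\<close> is what gives \<open>U s = a\<close> for all s \<le> 0;
    \<open>insert a\<close> keeps the supremum defined there.\<close>
  define V where "V s = insert a {u \<in> {a..b}. 0 < s \<and> l u \<le> ennreal s}" for s
  define U where "U s = Sup (V s)" for s
  have Vab: "V s \<subseteq> {a..b}" for s
    using ab by (auto simp: V_def)
  have bdd: "bdd_above (V s)" for s
    using Vab[of s] by (meson bdd_above_Icc bdd_above_mono)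
  have Uab: "U s \<in> {a..b}" for s
    unfolding U_def atLeastAtMost_iff
    using bdd Vab[of s] by (auto intro!: cSup_upper cSup_least simp: V_def)
  have ne: "V s \<noteq> {}" for s by (simp add: V_def)
  have U_mono: "U s \<le> U t" if "s \<le> t" for s t
    unfolding U_def
  proof (rule cSup_subset_mono[OF ne bdd])
    show "V s \<subseteq> V t"
      using that order_trans[OF _ ennreal_leI[OF that]] by (auto simp: V_def)
  qed
  \<comment> \<open>Beyond \<open>U s\<close> the length is at least \<open>s\<close>, and on
    \<open>V t\<close> it is at most \<open>t\<close>, so at most \<open>t - s\<close> remains for
    the piece from \<open>u\<close> to \<open>v\<close>.\<close>
  have mid: "\<sigma> (\<gamma> u) (\<gamma> v) \<le> ennreal (t - s)"
    if "s < t" "U s < u" "u \<le> v" "v \<in> V t" for s t u v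
  proof -
    have au: "a \<le> U s" using Uab[of s] by simp
    have u: "u \<in> {a..b}" and v: "v \<in> {a..b}"
      using that Uab[of s] Vab[of t] by auto
    have "u \<notin> V s"
      using that(2) cSup_upper[OF _ bdd] unfolding U_def by force
    then have lu: "ennreal s \<le> l u"
      using u by (cases "s > 0") (auto simp: V_def ennreal_neg)
    have lv: "l v \<le> ennreal t" "t > 0"
      using that au by (auto simp: V_def)
    have "ennreal s + \<sigma> (\<gamma> u) (\<gamma> v) \<le> l u + \<sigma> (\<gamma> v) (\<gamma> u)"
      using lu ext_pseudometric_onD(2)[OF ps M[OF u] M[OF v]] by (simp add: add_mono)
    also have "\<dots> \<le> l v"
      unfolding l_def using path_len_add_step[of a u v] u that(3) by auto
    finally have *: "ennreal s + \<sigma> (\<gamma> u) (\<gamma> v) \<le> ennreal t"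
      using lv by simp
    show ?thesis
    proof (cases "s \<ge> 0")
      case True
      have "\<sigma> (\<gamma> u) (\<gamma> v) \<le> ennreal t - ennreal s"
        using * by (subst ennreal_le_minus_iff) (simp add: add.commute)
      then show ?thesis using True by (simp add: ennreal_minus)
    next
      case False
      then have "\<sigma> (\<gamma> u) (\<gamma> v) \<le> ennreal t"
        using * by (simp add: ennreal_neg)
      also have "\<dots> \<le> ennreal (t - s)"
        using False by (intro ennreal_leI) simp
      finally show ?thesis .
    qed
  qed
  \<comment> \<open>The estimate \<open>mid\<close> does not cover the suprema themselves. They are
    approached by \<open>u\<close> slightly above \<open>U s\<close> and \<open>v \<in> V t\<close>
    at or slightly below \<open>U t\<close>; continuity of \<open>\<gamma>\<close> bounds each of
    the two errors by \<open>e/2\<close>.\<close>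
  have main: "\<sigma> (\<gamma> (U s)) (\<gamma> (U t)) \<le> ennreal (t - s)" if "s < t" for s t
  proof (cases "U s = U t")
    case True
    then show ?thesis using ext_pseudometric_onD(1)[OF ps M[OF Uab]] by simp
  next
    case False
    then have lt: "U s < U t" using U_mono[of s t] that by simp
    show ?thesis
    proof (rule ennreal_le_epsilon)
      fix e :: real assume "e > 0"
      then have e: "ennreal (e/2) > 0" by simp
      obtain \<delta>1 where \<delta>1: "\<delta>1 > 0"
        "\<And>v. v \<in> {a..b} \<Longrightarrow> \<bar>v - U s\<bar> < \<delta>1 \<Longrightarrow> \<sigma> (\<gamma> (U s)) (\<gamma> v) < ennreal (e/2)"
        using continuous_ext_mtopologyD[OF ps cont Uab e] by metis
      obtain \<delta>2 where \<delta>2: "\<delta>2 > 0"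
        "\<And>v. v \<in> {a..b} \<Longrightarrow> \<bar>v - U t\<bar> < \<delta>2 \<Longrightarrow> \<sigma> (\<gamma> (U t)) (\<gamma> v) < ennreal (e/2)"
        using continuous_ext_mtopologyD[OF ps cont Uab e] by metis
      define u where "u = U s + min \<delta>1 (U t - U s) / 2"
      have u: "U s < u" "u < U t" "\<bar>u - U s\<bar> < \<delta>1"
        using \<delta>1(1) lt by (auto simp: u_def min_def field_simps)
      have "max u (U t - \<delta>2) < Sup (V t)"
        using u(2) \<delta>2(1) by (simp add: U_def)
      then obtain v where v: "v \<in> V t" "max u (U t - \<delta>2) < v"
        using less_cSup_iff[OF ne bdd] by blast
      have vt: "v \<le> U t" unfolding U_def using v(1) bdd by (rule cSup_upper)
      have uab: "u \<in> {a..b}"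
        using u Uab[of s] Uab[of t] by auto
      have vab: "v \<in> {a..b}"
        using v(1) Vab by blast
      have "\<sigma> (\<gamma> (U s)) (\<gamma> (U t)) \<le> \<sigma> (\<gamma> (U s)) (\<gamma> u) + (\<sigma> (\<gamma> u) (\<gamma> v) + \<sigma> (\<gamma> v) (\<gamma> (U t)))"
        using ext_pseudometric_onD(3)[OF ps] M uab vab Uab
        by (meson add_left_mono order_trans)
      also have "\<dots> \<le> ennreal (e/2) + (ennreal (t - s) + ennreal (e/2))"
      proof (intro add_mono)
        show "\<sigma> (\<gamma> (U s)) (\<gamma> u) \<le> ennreal (e/2)"
          using \<delta>1(2)[OF uab u(3)] by simp
        show "\<sigma> (\<gamma> u) (\<gamma> v) \<le> ennreal (t - s)"
          using mid[OF that u(1) _ v(1)] v(2) by simp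
        have "\<sigma> (\<gamma> (U t)) (\<gamma> v) < ennreal (e/2)"
          using \<delta>2(2)[OF vab] vt v(2) by simp
        then show "\<sigma> (\<gamma> v) (\<gamma> (U t)) \<le> ennreal (e/2)"
          using ext_pseudometric_onD(2)[OF ps M[OF vab] M[OF Uab]] by simp
      qed
      also have "\<dots> = ennreal (t - s) + ennreal e"
        using that \<open>e > 0\<close> by (simp flip: ennreal_plus)
      finally show "\<sigma> (\<gamma> (U s)) (\<gamma> (U t)) \<le> ennreal (t - s) + ennreal e" .
    qed
  qed
  have "short_curve M \<sigma> (\<lambda>s. \<gamma> (U s))"
    by (rule short_curve_lessI[OF ps M[OF Uab] main])
  moreover have "U 0 = a" by (simp add: U_def V_def)
  moreover have "b \<in> V L"
    using ab L len by (auto simp: V_def l_def)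
  then have "U L = b"
    using Uab[of L] cSup_upper[OF _ bdd, of b L] by (simp add: U_def)
  ultimately show ?thesis
    using xy by (intro exI[of _ "\<lambda>s. \<gamma> (U s)"]) simp
qed

lemma short_curve_continuous_map:
  assumes "short_curve M \<sigma> c"
  shows "continuous_map (top_of_set S) (ext_mtopology M \<sigma>) c"
  unfolding continuous_map
proof (intro conjI allI impI)
  show "c ` topspace (top_of_set S) \<subseteq> topspace (ext_mtopology M \<sigma>)"
    using assms by (auto simp: short_curve_def)
  fix U assume U: "openin (ext_mtopology M \<sigma>) U"
  show "openin (top_of_set S) {x \<in> topspace (top_of_set S). c x \<in> U}"
    unfolding openin_euclidean_subtopology_iff
  proof (intro conjI ballI)
    fix v assume "v \<in> {x \<in> topspace (top_of_set S). c x \<in> U}"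
    then have v: "v \<in> S" "c v \<in> U" by auto
    then obtain r where r: "r > 0" "\<And>y. y \<in> M \<Longrightarrow> \<sigma> (c v) y < r \<Longrightarrow> y \<in> U"
      using U unfolding openin_ext_mtopology by meson
    obtain q where q: "q > 0" "ennreal q \<le> r"
    proof (cases r)
      case (real q)
      then show ?thesis using r(1) that[of q] by auto
    next
      case top
      then show ?thesis using that[of 1] by auto
    qed
    have "c w \<in> U" if "dist w v < q" for w
    proof (rule r(2))
      show "c w \<in> M" using assms by (simp add: short_curve_def)
      have "\<sigma> (c v) (c w) \<le> ennreal \<bar>v - w\<bar>" using assms by (simp add: short_curve_def)
      also have "\<dots> < ennreal q"
        using that q by (intro ennreal_lessI) (auto simp: dist_real_def)
      finally show "\<sigma> (c v) (c w) < r" using q by simp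
    qed
    then show "\<exists>e>0. \<forall>x'\<in>S. dist x' v < e \<longrightarrow> x' \<in> {x \<in> topspace (top_of_set S). c x \<in> U}"
      using q(1) by auto
  qed auto
qed

lemma path_len_short_curve:
  assumes "short_curve M \<sigma> c"
  shows "path_len \<sigma> a b c \<le> ennreal (b - a)"
  unfolding path_len_def
proof (rule Sup_least, clarify)
  fix N and t :: "nat \<Rightarrow> real"
  assume t: "\<forall>i<N. t i \<le> t (Suc i)"
  have "(\<Sum>i<N. \<sigma> (c (t (Suc i))) (c (t i))) \<le> (\<Sum>i<N. ennreal (t (Suc i) - t i))"
  proof (rule sum_mono)
    fix i assume "i \<in> {..<N}"
    then show "\<sigma> (c (t (Suc i))) (c (t i)) \<le> ennreal (t (Suc i) - t i)"
      using assms t unfolding short_curve_def by (metis abs_of_nonneg diff_ge_0_iff_ge lessThan_iff)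
  qed
  also have "\<dots> = ennreal (\<Sum>i<N. t (Suc i) - t i)"
    using t by (intro sum_ennreal) auto
  also have "(\<Sum>i<N. t (Suc i) - t i) = t N - t 0"
    by (rule sum_lessThan_telescope)
  finally show "(\<Sum>i<N. \<sigma> (c (t (Suc i))) (c (t i))) \<le> ennreal (t N - t 0)" .
qed

text \<open>Converse to the parametrization by arc length: a piece of a short curve is a competitor
  in the infimum, of length at most its duration.\<close>

lemma induced_intrinsic_le_short_curve:
  assumes c: "short_curve M \<sigma> c" and "s \<le> t"
  shows "induced_intrinsic M \<sigma> (c s) (c t) \<le> ennreal (t - s)"
proof -
  have "induced_intrinsic M \<sigma> (c s) (c t) \<le> path_len \<sigma> s t c"
    unfolding induced_intrinsic_def
    using assms short_curve_continuous_map[OF c] by (intro Inf_lower) blast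
  then show ?thesis
    using path_len_short_curve[OF c] order_trans by blast
qed

section \<open>Reversal and concatenation of short curves\<close>

lemma short_curve_reflect:
  assumes "short_curve M \<sigma> c"
  shows "short_curve M \<sigma> (\<lambda>s. c (a - s))"
proof (rule short_curveI)
  fix s t
  have "\<sigma> (c (a - s)) (c (a - t)) \<le> ennreal \<bar>(a - s) - (a - t)\<bar>"
    using assms by (simp only: short_curve_def)
  also have "\<bar>(a - s) - (a - t)\<bar> = \<bar>s - t\<bar>" by simp
  finally show "\<sigma> (c (a - s)) (c (a - t)) \<le> ennreal \<bar>s - t\<bar>" .
qed (use assms in \<open>auto simp: short_curve_def\<close>)

lemma short_curve_append:
  assumes ps: "ext_pseudometric_on M \<sigma>"
    and c: "short_curve M \<sigma> c" and c': "short_curve M \<sigma> c'" and join: "c L = c' 0"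
  shows "short_curve M \<sigma> (\<lambda>s. if s \<le> L then c s else c' (s - L))"
proof (rule short_curve_lessI[OF ps])
  fix s t :: real assume st: "s < t"
  have le: "\<sigma> (c s) (c t) \<le> ennreal \<bar>s - t\<bar>" "\<sigma> (c' s) (c' t) \<le> ennreal \<bar>s - t\<bar>" for s t
    using c c' by (auto simp: short_curve_def)
  consider "t \<le> L" | "s \<le> L" "L < t" | "L < s" by linarith
  then show "\<sigma> (if s \<le> L then c s else c' (s - L)) (if t \<le> L then c t else c' (t - L)) \<le> ennreal (t - s)"
  proof cases
    case 2
    have "\<sigma> (c s) (c' (t - L)) \<le> \<sigma> (c s) (c L) + \<sigma> (c' 0) (c' (t - L))"
      using ext_pseudometric_onD(3)[OF ps] c c' join by (simp add: short_curve_def)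
    also have "\<dots> \<le> ennreal (L - s) + ennreal (t - L)"
      using le(1)[of s L] le(2)[of 0 "t - L"] 2 by (intro add_mono) auto
    also have "\<dots> = ennreal (t - s)"
      using 2 by (simp flip: ennreal_plus)
    finally show ?thesis using 2 by simp
  qed (use st le(1)[of s t] le(2)[of "s - L" "t - L"] in auto)
qed (use c c' in \<open>auto simp: short_curve_def\<close>)

lemma short_curve_dist_le:
  assumes "short_curve M \<sigma> c" "c 0 = x" "c L = y" "L \<ge> 0"
  shows "\<sigma> x y \<le> ennreal L"
proof -
  have "\<sigma> (c 0) (c L) \<le> ennreal \<bar>0 - L\<bar>"
    using assms(1) unfolding short_curve_def by blast
  then show ?thesis using assms by simp
qed

lemma le_induced_intrinsic:
  assumes "ext_pseudometric_on M \<sigma>"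
  shows "\<sigma> x y \<le> induced_intrinsic M \<sigma> x y"
proof (rule ennreal_le_of_less_real)
  fix L :: real assume "L > 0" "induced_intrinsic M \<sigma> x y < ennreal L"
  then obtain c where "short_curve M \<sigma> c" "c 0 = x" "c L = y"
    using induced_intrinsic_less_imp_short_curve[OF assms] by blast
  then show "\<sigma> x y \<le> ennreal L"
    using \<open>L > 0\<close> short_curve_dist_le[of M \<sigma> c x L y] by simp
qed

text \<open>Symmetry comes from running a short curve backwards, the triangle inequality from
  concatenating two short curves whose durations exceed the infima by \<open>e/2\<close>
  each.\<close>

lemma ext_pseudometric_on_induced_intrinsic:
  assumes ps: "ext_pseudometric_on M \<sigma>"
  shows "ext_pseudometric_on M (induced_intrinsic M \<sigma>)"
proof (rule ext_pseudometric_onI)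
  fix x assume "x \<in> M"
  then have "short_curve M \<sigma> (\<lambda>_. x)"
    using ext_pseudometric_onD(1)[OF ps] by (simp add: short_curve_def)
  from induced_intrinsic_le_short_curve[OF this, of 0 0]
  show "induced_intrinsic M \<sigma> x x = 0" by simp
next
  have le: "induced_intrinsic M \<sigma> y x \<le> induced_intrinsic M \<sigma> x y" for x y
  proof (rule ennreal_le_of_less_real)
    fix L :: real assume "L > 0" "induced_intrinsic M \<sigma> x y < ennreal L"
    then obtain c where "short_curve M \<sigma> c" "c 0 = x" "c L = y"
      using induced_intrinsic_less_imp_short_curve[OF ps] by blast
    then show "induced_intrinsic M \<sigma> y x \<le> ennreal L"
      using induced_intrinsic_le_short_curve[OF short_curve_reflect[of M \<sigma> c L], of 0 L] \<open>L > 0\<close>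
      by simp
  qed
  show "induced_intrinsic M \<sigma> x y = induced_intrinsic M \<sigma> y x" for x y
    using le by (simp add: order_antisym)
next
  fix x y z
  let ?h = "induced_intrinsic M \<sigma>"
  show "?h x z \<le> ?h x y + ?h y z"
  proof (cases "?h x y = Orderings.top \<or> ?h y z = Orderings.top")
    case False
    then obtain p q where pq: "?h x y = ennreal p" "?h y z = ennreal q" "p \<ge> 0" "q \<ge> 0"
      by (metis ennreal_cases)
    show ?thesis
    proof (rule ennreal_le_epsilon)
      fix e :: real assume e: "e > 0"
      have "?h x y < ennreal (p + e/2)" "?h y z < ennreal (q + e/2)"
        using pq e by (auto simp: ennreal_less_iff)
      then obtain c c' where c: "short_curve M \<sigma> c" "c 0 = x" "c (p + e/2) = y"
        and c': "short_curve M \<sigma> c'" "c' 0 = y" "c' (q + e/2) = z"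
        using induced_intrinsic_less_imp_short_curve[OF ps] by metis
      have "?h x z \<le> ennreal (p + e/2 + (q + e/2))"
        using induced_intrinsic_le_short_curve
            [OF short_curve_append[OF ps c(1) c'(1), of "p + e/2"], of 0 "p + e/2 + (q + e/2)"]
          c c' pq e by (simp add: add.commute)
      also have "\<dots> = ?h x y + ?h y z + ennreal e"
        using pq e by (simp add: algebra_simps flip: ennreal_plus)
      finally show "?h x z \<le> ?h x y + ?h y z + ennreal e" .
    qed
  qed auto
qed

text \<open>Passing to the intrinsic metric is invisible to short curves, so the sequence can be
  followed by its short curves alone.\<close>

lemma short_curve_induced_intrinsic_iff:
  assumes ps: "ext_pseudometric_on M \<sigma>"
  shows "short_curve M (induced_intrinsic M \<sigma>) c \<longleftrightarrow> short_curve M \<sigma> c"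
proof
  assume "short_curve M (induced_intrinsic M \<sigma>) c"
  then show "short_curve M \<sigma> c"
    unfolding short_curve_def using le_induced_intrinsic[OF ps] order_trans by blast
next
  assume c: "short_curve M \<sigma> c"
  show "short_curve M (induced_intrinsic M \<sigma>) c"
    by (rule short_curve_lessI[OF ext_pseudometric_on_induced_intrinsic[OF ps]])
      (use c induced_intrinsic_le_short_curve[OF c] in \<open>auto simp: short_curve_def\<close>)
qed

section \<open>Translations by the finite set\<close>

text \<open>\<open>hausdorff_orbit\<close> compares \<open>g \<otimes> x\<close> with
  \<open>h \<otimes> x\<close>, so it is multiplication by \<open>x\<close> on the right whose
  continuity enters.\<close>

locale translated_metric = group G + Metric_space "carrier G" d
  for G :: "('a, 'b) monoid_scheme" (structure) and d :: "'a \<Rightarrow> 'a \<Rightarrow> real" +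
  assumes right_translation_continuous:
    "w \<in> carrier G \<Longrightarrow> continuous_map mtopology mtopology (\<lambda>x. x \<otimes> w)"
begin

lemma right_translation_close:
  assumes g: "g \<in> carrier G" and w: "w \<in> carrier G" and "e > 0"
  shows "\<exists>\<delta>>0. \<forall>h\<in>carrier G. d g h < \<delta> \<longrightarrow> d (g \<otimes> w) (h \<otimes> w) < e"
proof -
  let ?U = "{h \<in> topspace mtopology. h \<otimes> w \<in> mball (g \<otimes> w) e}"
  have "openin mtopology ?U"
    by (rule openin_continuous_map_preimage[OF right_translation_continuous[OF w] openin_mball])
  moreover have "g \<in> ?U"
    using assms by simp
  ultimately obtain \<delta> where "\<delta> > 0" "mball g \<delta> \<subseteq> ?U"
    unfolding openin_mtopology by blast
  then show ?thesis
    using g w by (auto simp: subset_iff)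
qed

end

lemma finite_uniform_radius:
  fixes P :: "'a \<Rightarrow> real \<Rightarrow> bool"
  assumes "finite S" and "\<And>y. y \<in> S \<Longrightarrow> \<exists>\<delta>>0. P y \<delta>"
    and anti: "\<And>y \<delta> \<delta>'. y \<in> S \<Longrightarrow> P y \<delta> \<Longrightarrow> 0 < \<delta>' \<Longrightarrow> \<delta>' \<le> \<delta> \<Longrightarrow> P y \<delta>'"
  shows "\<exists>\<delta>>0. \<forall>y\<in>S. P y \<delta>"
proof -
  obtain D where D: "\<And>y. y \<in> S \<Longrightarrow> D y > 0 \<and> P y (D y)"
    using assms(2) by metis
  define \<delta> where "\<delta> = Min (insert 1 (D ` S))"
  have "\<delta> > 0"
    using assms(1) D unfolding \<delta>_def by (subst Min_gr_iff) auto
  moreover have "\<delta> \<le> D y" if "y \<in> S" for y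
    using assms(1) that unfolding \<delta>_def by (intro Min_le) auto
  ultimately show ?thesis
    using D anti by blast
qed

section \<open>Hausdorff distances between orbit sets\<close>

lemma hausdorff_fin_le_iff:
  assumes "finite A" "A \<noteq> {}" "finite B" "B \<noteq> {}"
  shows "hausdorff_fin \<rho> A B \<le> r \<longleftrightarrow>
    (\<forall>a\<in>A. \<exists>b\<in>B. \<rho> a b \<le> r) \<and> (\<forall>b\<in>B. \<exists>a\<in>A. \<rho> a b \<le> r)"
  using assms by (simp add: hausdorff_fin_def Min_le_iff)

locale translated_metric_set = translated_metric +
  fixes X :: "'a set"
  assumes finite_X: "finite X" and X_subset: "X \<subseteq> carrier G" and one_X: "\<one> \<in> X"
    and stabilizer_X: "set_stabilizer G X = {\<one>}"
begin

lemma X_carrier [simp]: "x \<in> X \<Longrightarrow> x \<in> carrier G"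
  using X_subset by blast

lemma hausdorff_orbit_le_iff:
  "hausdorff_orbit G X \<rho> g h \<le> r \<longleftrightarrow>
    (\<forall>x\<in>X. \<exists>y\<in>X. \<rho> (g \<otimes> x) (h \<otimes> y) \<le> r) \<and> (\<forall>y\<in>X. \<exists>x\<in>X. \<rho> (g \<otimes> x) (h \<otimes> y) \<le> r)"
proof -
  have "g <# X = (\<lambda>x. g \<otimes> x) ` X" for g
    by (auto simp: l_coset_def)
  then show ?thesis
    using finite_X one_X unfolding hausdorff_orbit_def
    by (subst hausdorff_fin_le_iff) auto
qed

text \<open>As \<open>X\<close> is finite, the minima are attained: every point of one orbit set has
  a partner in the other within the Hausdorff distance itself. Composing partners gives the triangle
  inequality.\<close>

lemma ext_pseudometric_on_hausdorff_orbit: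
  assumes ps: "ext_pseudometric_on (carrier G) \<rho>"
  shows "ext_pseudometric_on (carrier G) (hausdorff_orbit G X \<rho>)"
proof (rule ext_pseudometric_onI)
  let ?H = "hausdorff_orbit G X \<rho>"
  note D = ext_pseudometric_onD[OF ps]
  show "?H g g = 0" if "g \<in> carrier G" for g
  proof -
    have "?H g g \<le> 0"
      unfolding hausdorff_orbit_le_iff using that by (metis D(1) X_carrier m_closed order_refl)
    then show ?thesis by simp
  qed
  have "?H h g \<le> ?H g h" if gh: "g \<in> carrier G" "h \<in> carrier G" for g h
  proof -
    have "\<rho> (h \<otimes> y) (g \<otimes> x) = \<rho> (g \<otimes> x) (h \<otimes> y)" if "x \<in> X" "y \<in> X" for x y
      using gh that by (intro D(2)) auto
    moreover have "?H g h \<le> ?H g h" ..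
    ultimately show ?thesis
      unfolding hausdorff_orbit_le_iff[of \<rho> h g] hausdorff_orbit_le_iff[of \<rho> g h "?H g h"]
      by metis
  qed
  then show "?H g h = ?H h g" if "g \<in> carrier G" "h \<in> carrier G" for g h
    using that by (simp add: order_antisym)
  show "?H g k \<le> ?H g h + ?H h k"
    if ghk: "g \<in> carrier G" "h \<in> carrier G" "k \<in> carrier G" for g h k
  proof -
    have tri: "\<rho> (g \<otimes> x) (k \<otimes> z) \<le> ?H g h + ?H h k"
      if "\<rho> (g \<otimes> x) (h \<otimes> y) \<le> ?H g h" "\<rho> (h \<otimes> y) (k \<otimes> z) \<le> ?H h k" "x \<in> X" "y \<in> X" "z \<in> X"
      for x y z
      using order_trans[OF D(3) add_mono[OF that(1,2)]] ghk that by simp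
    have "?H g h \<le> ?H g h" "?H h k \<le> ?H h k" by simp_all
    then have 1: "\<forall>x\<in>X. \<exists>y\<in>X. \<rho> (g \<otimes> x) (h \<otimes> y) \<le> ?H g h"
        "\<forall>y\<in>X. \<exists>x\<in>X. \<rho> (g \<otimes> x) (h \<otimes> y) \<le> ?H g h"
      and 2: "\<forall>y\<in>X. \<exists>z\<in>X. \<rho> (h \<otimes> y) (k \<otimes> z) \<le> ?H h k"
        "\<forall>z\<in>X. \<exists>y\<in>X. \<rho> (h \<otimes> y) (k \<otimes> z) \<le> ?H h k"
      unfolding hausdorff_orbit_le_iff by simp_all
    show ?thesis
      unfolding hausdorff_orbit_le_iff[of \<rho> g k]
    proof (intro conjI ballI)
      fix x assume x: "x \<in> X"
      with 1 obtain y where y: "y \<in> X" "\<rho> (g \<otimes> x) (h \<otimes> y) \<le> ?H g h" by blast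
      with 2 obtain z where "z \<in> X" "\<rho> (h \<otimes> y) (k \<otimes> z) \<le> ?H h k" by blast
      with tri x y show "\<exists>z\<in>X. \<rho> (g \<otimes> x) (k \<otimes> z) \<le> ?H g h + ?H h k" by blast
    next
      fix z assume z: "z \<in> X"
      with 2 obtain y where y: "y \<in> X" "\<rho> (h \<otimes> y) (k \<otimes> z) \<le> ?H h k" by blast
      with 1 obtain x where "x \<in> X" "\<rho> (g \<otimes> x) (h \<otimes> y) \<le> ?H g h" by blast
      with tri z y show "\<exists>x\<in>X. \<rho> (g \<otimes> x) (k \<otimes> z) \<le> ?H g h + ?H h k" by blast
    qed
  qed
qed

section \<open>Rigidity from the trivial stabilizer\<close>

text \<open>An injective map of the finite set \<open>X\<close> into itself is onto, so otherwise
  \<open>y\<close> would lie in the stabilizer.\<close>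

lemma moved_outside_X:
  assumes "y \<in> X" "y \<noteq> \<one>"
  obtains x where "x \<in> X" "y \<otimes> x \<notin> X"
proof (rule ccontr)
  assume "\<not> thesis"
  then have sub: "(\<lambda>x. y \<otimes> x) ` X \<subseteq> X"
    using that by blast
  have "inj_on (\<lambda>x. y \<otimes> x) X"
    using assms(1) by (intro inj_onI) simp
  then have "(\<lambda>x. y \<otimes> x) ` X = X"
    using sub finite_X by (simp add: card_image card_subset_eq)
  then have "y <# X = X"
    by (auto simp: l_coset_def)
  then have "y \<in> set_stabilizer G X"
    using assms by (simp add: set_stabilizer_def)
  then show False
    using stabilizer_X assms(2) by simp
qed

text \<open>A point whose translates are close to those of \<open>g\<close> up to a permutation can only be close to
  \<open>g \<otimes> y\<close> for \<open>y = \<one>\<close>, because otherwise \<open>y\<close> would move \<open>X\<close> into itself.\<close>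

lemma close_of_close_translates:
  assumes g: "g \<in> carrier G" and "e > 0"
  shows "\<exists>\<delta>>0. \<forall>h\<in>carrier G. (\<forall>x\<in>X. \<exists>z\<in>X. d (g \<otimes> z) (h \<otimes> x) < \<delta>) \<longrightarrow> d g h < e"
proof -
  \<comment> \<open>\<open>P y \<delta>\<close> forbids \<open>h\<close> to be near
    \<open>g \<otimes> y\<close> at scale \<open>\<delta>\<close>. It is inherited by smaller
    scales, so one scale will serve all \<open>y \<noteq> \<one>\<close>.\<close>
  define P where "P y \<delta> \<longleftrightarrow> (\<forall>h\<in>carrier G. (\<forall>x\<in>X. \<exists>z\<in>X. d (g \<otimes> z) (h \<otimes> x) < \<delta>) \<longrightarrow>
    \<not> d (g \<otimes> y) h < \<delta>)" for y \<delta>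
  have ex: "\<exists>\<delta>>0. P y \<delta>" if "y \<in> X - {\<one>}" for y
  proof -
    have y: "y \<in> X" "y \<noteq> \<one>" using that by auto
    obtain x where x: "x \<in> X" "y \<otimes> x \<notin> X" using moved_outside_X[OF y] .
    have gyx: "g \<otimes> y \<otimes> x \<noteq> g \<otimes> z" if "z \<in> X" for z
    proof
      assume "g \<otimes> y \<otimes> x = g \<otimes> z"
      then have "y \<otimes> x = z"
        using that x y g by (simp add: m_assoc)
      then show False using that x by simp
    qed
    \<comment> \<open>If \<open>h\<close> were near \<open>g \<otimes> y\<close>, then
      \<open>h \<otimes> x\<close> would be near \<open>g \<otimes> y \<otimes> x\<close>, which
      keeps distance \<open>\<eta>\<close> from every \<open>g \<otimes> z\<close>; but
      \<open>h \<otimes> x\<close> is close to one of these.\<close>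
    have "\<exists>\<eta>>0. \<forall>z\<in>X. \<eta> \<le> d (g \<otimes> y \<otimes> x) (g \<otimes> z)"
    proof (rule finite_uniform_radius[OF finite_X])
      show "\<exists>\<delta>>0. \<delta> \<le> d (g \<otimes> y \<otimes> x) (g \<otimes> z)" if "z \<in> X" for z
        using gyx[OF that] that x y g by (intro exI[of _ "d (g \<otimes> y \<otimes> x) (g \<otimes> z)"]) auto
    qed auto
    then obtain \<eta> where \<eta>: "\<eta> > 0" "\<And>z. z \<in> X \<Longrightarrow> \<eta> \<le> d (g \<otimes> y \<otimes> x) (g \<otimes> z)"
      by blast
    obtain \<delta> where \<delta>: "\<delta> > 0"
      "\<And>h. h \<in> carrier G \<Longrightarrow> d (g \<otimes> y) h < \<delta> \<Longrightarrow> d (g \<otimes> y \<otimes> x) (h \<otimes> x) < \<eta> / 2"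
      using right_translation_close[of "g \<otimes> y" x "\<eta> / 2"] g x y \<eta>(1) by auto
    have "P y (min \<delta> (\<eta> / 2))"
      unfolding P_def
    proof (intro ballI impI notI)
      fix h assume h: "h \<in> carrier G" and tr: "\<forall>x\<in>X. \<exists>z\<in>X. d (g \<otimes> z) (h \<otimes> x) < min \<delta> (\<eta> / 2)"
        and near: "d (g \<otimes> y) h < min \<delta> (\<eta> / 2)"
      obtain z where z: "z \<in> X" "d (g \<otimes> z) (h \<otimes> x) < \<eta> / 2"
        using tr x(1) by auto
      have "d (g \<otimes> y \<otimes> x) (g \<otimes> z) \<le> d (g \<otimes> y \<otimes> x) (h \<otimes> x) + d (g \<otimes> z) (h \<otimes> x)"
        using triangle[of "g \<otimes> y \<otimes> x" "h \<otimes> x" "g \<otimes> z"] g h x y z(1)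
        by (simp add: commute[of "g \<otimes> z"])
      then show False
        using \<delta>(2)[OF h] near z(2) \<eta>(2)[OF z(1)] by simp
    qed
    then show ?thesis using \<delta>(1) \<eta>(1) by (intro exI[of _ "min \<delta> (\<eta> / 2)"]) auto
  qed
  have "\<exists>\<delta>>0. \<forall>y\<in>X - {\<one>}. P y \<delta>"
  proof (rule finite_uniform_radius[OF _ ex])
    show "P y \<delta>'" if "P y \<delta>" "\<delta>' \<le> \<delta>" for y \<delta> \<delta>'
      using that unfolding P_def by (meson order_less_le_trans)
  qed (use finite_X in auto)
  then obtain \<delta> where \<delta>: "\<delta> > 0" "\<And>y. y \<in> X - {\<one>} \<Longrightarrow> P y \<delta>"
    by blast
  show ?thesis
  proof (intro exI[of _ "min \<delta> e"] conjI ballI impI)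
    fix h assume h: "h \<in> carrier G"
      and tr: "\<forall>x\<in>X. \<exists>z\<in>X. d (g \<otimes> z) (h \<otimes> x) < min \<delta> e"
    \<comment> \<open>Applied to \<open>\<one> \<in> X\<close>, closeness of the translates yields a
      partner \<open>g \<otimes> y\<close> for \<open>h\<close> itself.\<close>
    obtain y where y: "y \<in> X" "d (g \<otimes> y) h < min \<delta> e"
      using bspec[OF tr one_X] h by auto
    have "y = \<one>"
    proof (rule ccontr)
      assume "y \<noteq> \<one>"
      then have "P y \<delta>" using \<delta> y by simp
      moreover have "\<forall>x\<in>X. \<exists>z\<in>X. d (g \<otimes> z) (h \<otimes> x) < \<delta>"
        using tr by (meson min_less_iff_conj)
      ultimately show False
        unfolding P_def using h y(2) by auto
    qed
    then show "d g h < e" using y g by simp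
  qed (use \<delta> assms in auto)
qed

text \<open>For \<open>h\<close> close to \<open>g\<close>, partners are forced:
  \<open>h \<otimes> x\<close> is near \<open>g \<otimes> x\<close>, while the points of
  \<open>g <# X\<close> are separated in \<open>d\<close>, hence in any larger
  \<open>\<rho>\<close>. Far from \<open>g\<close> a matching might permute \<open>X\<close>, so the
  comparison is local.\<close>

lemma translates_le_hausdorff_orbit:
  assumes g: "g \<in> carrier G"
  obtains \<eta> where "\<eta> > 0"
    "\<And>\<rho> h x. \<lbrakk>\<And>a b. \<lbrakk>a \<in> carrier G; b \<in> carrier G\<rbrakk> \<Longrightarrow> ennreal (d a b) \<le> \<rho> a b; h \<in> carrier G;
      hausdorff_orbit G X \<rho> g h < ennreal \<eta>; x \<in> X\<rbrakk> \<Longrightarrow>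
      \<rho> (g \<otimes> x) (h \<otimes> x) \<le> hausdorff_orbit G X \<rho> g h"
proof -
  have "\<exists>\<eta>>0. \<forall>p\<in>X \<times> X. fst p \<noteq> snd p \<longrightarrow> \<eta> \<le> d (g \<otimes> fst p) (g \<otimes> snd p)"
  proof (rule finite_uniform_radius)
    show "\<exists>\<delta>>0. fst p \<noteq> snd p \<longrightarrow> \<delta> \<le> d (g \<otimes> fst p) (g \<otimes> snd p)" if "p \<in> X \<times> X" for p
    proof (cases "fst p = snd p")
      case False
      then show ?thesis
        using that g by (intro exI[of _ "d (g \<otimes> fst p) (g \<otimes> snd p)"]) auto
    qed (auto intro: exI[of _ 1])
  qed (use finite_X in auto)
  then obtain \<eta> where \<eta>: "\<eta> > 0"
    "\<And>x y. x \<in> X \<Longrightarrow> y \<in> X \<Longrightarrow> x \<noteq> y \<Longrightarrow> \<eta> \<le> d (g \<otimes> x) (g \<otimes> y)"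
    by auto
  have "\<exists>\<epsilon>>0. \<forall>x\<in>X. \<forall>h\<in>carrier G. d g h < \<epsilon> \<longrightarrow> d (g \<otimes> x) (h \<otimes> x) < \<eta> / 2"
  proof (rule finite_uniform_radius[OF finite_X])
    show "\<exists>\<delta>>0. \<forall>h\<in>carrier G. d g h < \<delta> \<longrightarrow> d (g \<otimes> x) (h \<otimes> x) < \<eta> / 2" if "x \<in> X" for x
      using right_translation_close[OF g X_carrier[OF that], of "\<eta> / 2"] \<eta>(1) by simp
  qed auto
  then obtain \<epsilon> where \<epsilon>: "\<epsilon> > 0"
    "\<And>x h. x \<in> X \<Longrightarrow> h \<in> carrier G \<Longrightarrow> d g h < \<epsilon> \<Longrightarrow> d (g \<otimes> x) (h \<otimes> x) < \<eta> / 2"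
    by blast
  obtain \<delta> where \<delta>: "\<delta> > 0"
    "\<And>h. h \<in> carrier G \<Longrightarrow> \<forall>x\<in>X. \<exists>z\<in>X. d (g \<otimes> z) (h \<otimes> x) < \<delta> \<Longrightarrow> d g h < \<epsilon>"
    using close_of_close_translates[OF g \<epsilon>(1)] by blast
  show ?thesis
  \<comment> \<open>The bound \<open>\<delta>\<close> forces \<open>d g h < \<epsilon>\<close>, so
    that translates move by less than \<open>\<eta> / 2\<close>; the bound \<open>\<eta> / 2\<close>
    keeps the partner of \<open>g \<otimes> x\<close> that close as well. Two different points of
    \<open>g <# X\<close> would then be less than \<open>\<eta>\<close> apart.\<close>
  proof (rule that[of "min \<delta> (\<eta> / 2)"])
    fix \<rho> h x
    assume le: "\<And>a b. \<lbrakk>a \<in> carrier G; b \<in> carrier G\<rbrakk> \<Longrightarrow> ennreal (d a b) \<le> \<rho> a b"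
      and h: "h \<in> carrier G" and less: "hausdorff_orbit G X \<rho> g h < ennreal (min \<delta> (\<eta> / 2))"
      and x: "x \<in> X"
    let ?H = "hausdorff_orbit G X \<rho> g h"
    have dless: "d (g \<otimes> y) (h \<otimes> z) < min \<delta> (\<eta> / 2)"
      if "\<rho> (g \<otimes> y) (h \<otimes> z) \<le> ?H" "y \<in> X" "z \<in> X" for y z
    proof -
      have "ennreal (d (g \<otimes> y) (h \<otimes> z)) \<le> \<rho> (g \<otimes> y) (h \<otimes> z)"
        using le g h that by simp
      also have "\<dots> < ennreal (min \<delta> (\<eta> / 2))"
        using that(1) less by (rule order_le_less_trans)
      finally show ?thesis by (simp add: ennreal_less_iff)
    qed
    have H: "\<forall>x\<in>X. \<exists>y\<in>X. \<rho> (g \<otimes> x) (h \<otimes> y) \<le> ?H" "\<forall>y\<in>X. \<exists>x\<in>X. \<rho> (g \<otimes> x) (h \<otimes> y) \<le> ?H"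
      using order_refl[of ?H] unfolding hausdorff_orbit_le_iff by simp_all
    have "d g h < \<epsilon>"
      using H(2) dless by (intro \<delta>(2)[OF h]) fastforce
    obtain y where y: "y \<in> X" "\<rho> (g \<otimes> x) (h \<otimes> y) \<le> ?H"
      using H(1) x by blast
    have "x = y"
    proof (rule ccontr)
      assume "x \<noteq> y"
      then have "\<eta> \<le> d (g \<otimes> x) (g \<otimes> y)"
        using \<eta>(2) x y by simp
      also have "\<dots> \<le> d (g \<otimes> x) (h \<otimes> y) + d (g \<otimes> y) (h \<otimes> y)"
        using triangle[of "g \<otimes> x" "h \<otimes> y" "g \<otimes> y"] g h x y(1) by (simp add: commute[of "g \<otimes> y"])
      also have "\<dots> < \<eta> / 2 + \<eta> / 2"
        using dless[OF y(2) x y(1)] \<epsilon>(2)[OF y(1) h \<open>d g h < \<epsilon>\<close>] by simp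
      finally show False by simp
    qed
    then show "\<rho> (g \<otimes> x) (h \<otimes> x) \<le> ?H" using y by simp
  qed (use \<delta> \<eta> in auto)
qed

text \<open>Being 1-Lipschitz is a local property of curves, so the local comparison suffices in one
  direction. In the other, pairing \<open>g \<otimes> x\<close> with \<open>h \<otimes> x\<close>
  bounds the Hausdorff distance.\<close>

lemma short_curve_hausdorff_orbit_iff:
  assumes ps: "ext_pseudometric_on (carrier G) \<rho>"
    and le: "\<And>a b. a \<in> carrier G \<Longrightarrow> b \<in> carrier G \<Longrightarrow> ennreal (d a b) \<le> \<rho> a b"
  shows "short_curve (carrier G) (hausdorff_orbit G X \<rho>) c \<longleftrightarrow>
    (\<forall>s. c s \<in> carrier G) \<and> (\<forall>x\<in>X. short_curve (carrier G) \<rho> (\<lambda>s. c s \<otimes> x))"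
proof (intro iffI conjI allI ballI)
  fix x assume c: "short_curve (carrier G) (hausdorff_orbit G X \<rho>) c" and x: "x \<in> X"
  have M: "c s \<in> carrier G" for s
    using c by (simp add: short_curve_def)
  show "short_curve (carrier G) \<rho> (\<lambda>s. c s \<otimes> x)"
  proof (rule short_curve_lessI[OF ps])
    fix s t :: real assume "s < t"
    then have "s \<le> t" by simp
    then show "\<rho> (c s \<otimes> x) (c t \<otimes> x) \<le> ennreal (t - s)"
    \<comment> \<open>Bisection: the bound adds up over adjacent intervals and holds on all
      sufficiently short intervals around each point.\<close>
    proof (induction rule: Bolzano)
      case (trans p q r)
      have "\<rho> (c p \<otimes> x) (c r \<otimes> x) \<le> ennreal (q - p) + ennreal (r - q)"
        using order_trans[OF ext_pseudometric_onD(3)[OF ps] add_mono[OF trans(1,2)]] M x by simp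
      then show ?case
        using trans by (simp flip: ennreal_plus)
    next
      case (local s)
      obtain \<eta> where \<eta>: "\<eta> > 0" "\<And>h. h \<in> carrier G \<Longrightarrow>
          hausdorff_orbit G X \<rho> (c s) h < ennreal \<eta> \<Longrightarrow>
          \<rho> (c s \<otimes> x) (h \<otimes> x) \<le> hausdorff_orbit G X \<rho> (c s) h"
        using translates_le_hausdorff_orbit[OF M[of s]] le x by metis
      have near: "\<rho> (c s \<otimes> x) (c t \<otimes> x) \<le> ennreal \<bar>s - t\<bar>" if "\<bar>s - t\<bar> < \<eta>" for t
      proof -
        have *: "hausdorff_orbit G X \<rho> (c s) (c t) \<le> ennreal \<bar>s - t\<bar>"
          using c by (simp add: short_curve_def)
        also have "\<dots> < ennreal \<eta>"
          using that by (intro ennreal_lessI) auto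
        finally show ?thesis
          using \<eta>(2)[OF M] * order_trans by blast
      qed
      \<comment> \<open>The radius \<open>\<eta>\<close> belongs to the centre \<open>c s\<close>,
        so an interval containing \<open>s\<close> is split at \<open>s\<close>.\<close>
      have "\<rho> (c a \<otimes> x) (c b \<otimes> x) \<le> ennreal (b - a)" if "a \<le> s" "s \<le> b" "b - a < \<eta>" for a b
      proof -
        have "\<rho> (c a \<otimes> x) (c b \<otimes> x) \<le> \<rho> (c a \<otimes> x) (c s \<otimes> x) + \<rho> (c s \<otimes> x) (c b \<otimes> x)"
          using ext_pseudometric_onD(3)[OF ps] M x by simp
        also have "\<rho> (c a \<otimes> x) (c s \<otimes> x) = \<rho> (c s \<otimes> x) (c a \<otimes> x)"
          using ext_pseudometric_onD(2)[OF ps] M x by simp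
        also have "\<dots> + \<rho> (c s \<otimes> x) (c b \<otimes> x) \<le> ennreal (s - a) + ennreal (b - s)"
          using near[of a] near[of b] that by (intro add_mono) auto
        also have "\<dots> = ennreal (b - a)"
          using that by (simp flip: ennreal_plus)
        finally show ?thesis .
      qed
      then show ?case using \<eta>(1) by blast
    qed
  qed (use M x in auto)
next
  assume c: "(\<forall>s. c s \<in> carrier G) \<and> (\<forall>x\<in>X. short_curve (carrier G) \<rho> (\<lambda>s. c s \<otimes> x))"
  show "short_curve (carrier G) (hausdorff_orbit G X \<rho>) c"
  proof (rule short_curveI)
    show "hausdorff_orbit G X \<rho> (c s) (c t) \<le> ennreal \<bar>s - t\<bar>" for s t
      unfolding hausdorff_orbit_le_iff using c unfolding short_curve_def by blast
  qed (use c in auto)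
qed (auto simp: short_curve_def)

end

section \<open>Compactness of families of short curves\<close>

context Metric_space
begin

lemma short_curve_ennreal_iff:
  "short_curve M (\<lambda>x y. ennreal (d x y)) c \<longleftrightarrow> (\<forall>s. c s \<in> M) \<and> (\<forall>s t. d (c s) (c t) \<le> \<bar>s - t\<bar>)"
  by (simp add: short_curve_def ennreal_le_iff)

section \<open>Hopf-Rinow argument for reachable sets\<close>

text \<open>Takes the place of closed balls: the balls of a complete, locally compact metric that is
  not intrinsic can fail to be relatively compact.\<close>

definition reach :: "'a \<Rightarrow> real \<Rightarrow> 'a set"
  where "reach g r =
    {c s | c s. 0 \<le> s \<and> s \<le> r \<and> short_curve M (\<lambda>x y. ennreal (d x y)) c \<and> c 0 = g}"

lemma reach_mono: "r \<le> r' \<Longrightarrow> reach g r \<subseteq> reach g r'"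
  unfolding reach_def by force

lemma reach_subset: "reach g r \<subseteq> M"
  by (auto simp: reach_def short_curve_def)

text \<open>Stop the curve leading to \<open>y\<close> at time \<open>r\<close>.\<close>

lemma reach_near:
  assumes "y \<in> reach g r'" "0 \<le> r" "r \<le> r'"
  obtains x where "x \<in> reach g r" "d x y \<le> r' - r"
proof -
  obtain c s where c: "0 \<le> s" "s \<le> r'" "short_curve M (\<lambda>x y. ennreal (d x y)) c" "c 0 = g" "y = c s"
    using assms(1) unfolding reach_def by blast
  have "c (min s r) \<in> reach g r"
    unfolding reach_def using c assms by force
  moreover have "d (c (min s r)) y \<le> \<bar>min s r - s\<bar>"
    using c(3,5) unfolding short_curve_ennreal_iff by blast
  moreover have "\<bar>min s r - s\<bar> \<le> r' - r"
    using c(2) assms(3) by linarith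
  ultimately show ?thesis
    using that order_trans by blast
qed

lemma mtotally_bounded_reach_0: "mtotally_bounded (reach g 0)"
proof -
  have "reach g 0 \<subseteq> {g} \<inter> M"
    using reach_subset[of g 0] by (auto simp: reach_def)
  then show ?thesis
    by (metis Int_insert_left Int_empty_left insertI1 mtotally_bounded_empty mtotally_bounded_sing
        mtotally_bounded_subset)
qed

text \<open>For \<open>r'\<close> within \<open>e / 2\<close> of \<open>r\<close>, an
  \<open>e / 2\<close>-net of \<open>reach g r'\<close> is an \<open>e\<close>-net of
  \<open>reach g r\<close>.\<close>

lemma mtotally_bounded_reach_limit:
  assumes "r > 0" and below: "\<And>r'. 0 \<le> r' \<Longrightarrow> r' < r \<Longrightarrow> mtotally_bounded (reach g r')"
  shows "mtotally_bounded (reach g r)"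
  unfolding mtotally_bounded_def
proof (intro allI impI)
  fix e :: real assume e: "e > 0"
  define r' where "r' = max 0 (r - e / 2)"
  have r': "0 \<le> r'" "r' < r" "r - r' \<le> e / 2"
    using assms(1) e unfolding r'_def by linarith+
  obtain K where K: "finite K" "K \<subseteq> reach g r'" "reach g r' \<subseteq> (\<Union>x\<in>K. mball x (e / 2))"
    using below[OF r'(1,2)] e unfolding mtotally_bounded_def by (meson half_gt_zero)
  have "y \<in> (\<Union>x\<in>K. mball x e)" if y: "y \<in> reach g r" for y
  proof -
    obtain x where x: "x \<in> reach g r'" "d x y \<le> r - r'"
      using reach_near[OF y r'(1)] r'(2) by force
    then obtain k where k: "k \<in> K" "x \<in> mball k (e / 2)"
      using K(3) by blast
    have "y \<in> M" using y reach_subset by blast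
    then have "d k y \<le> d k x + d x y"
      using k by (intro triangle) auto
    then show ?thesis
      using k x(2) r'(3) \<open>y \<in> M\<close> by (intro UN_I[of k]) auto
  qed
  moreover have "K \<subseteq> reach g r"
    using K(2) reach_mono[of r' r g] r'(2) by auto
  ultimately show "\<exists>K. finite K \<and> K \<subseteq> reach g r \<and> reach g r \<subseteq> (\<Union>x\<in>K. mball x e)"
    using K(1) by blast
qed

text \<open>Completeness makes the closure of the reachable set compact, and local compactness lets
  it be thickened: finitely many balls cover it whose doubles lie in compact sets.\<close>

lemma mtotally_bounded_reach_extend:
  assumes mc: mcomplete and lc: "locally_compact_space mtopology"
    and "r \<ge> 0" and tb: "mtotally_bounded (reach g r)"
  shows "\<exists>e>0. mtotally_bounded (reach g (r + e))"
proof -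
  define C where "C = mtopology closure_of (reach g r)"
  have C: "compactin mtopology C"
    using tb mtotally_bounded_eq_compact_closure_of[OF mc] unfolding C_def by blast
  then have CM: "C \<subseteq> M"
    using compactin_subset_topspace by fastforce
  have "\<exists>e K. e > 0 \<and> compactin mtopology K \<and> mball x (2 * e) \<subseteq> K" if "x \<in> C" for x
  proof -
    have "x \<in> topspace mtopology" using that CM by auto
    then obtain U K where UK: "openin mtopology U" "compactin mtopology K" "x \<in> U" "U \<subseteq> K"
      using lc unfolding locally_compact_space_def by blast
    then obtain e where "e > 0" "mball x e \<subseteq> U"
      unfolding openin_mtopology by blast
    then show ?thesis
      using UK by (intro exI[of _ "e / 2"] exI[of _ K]) auto
  qed
  then obtain e K where eK: "\<And>x. x \<in> C \<Longrightarrow> e x > 0 \<and> compactin mtopology (K x) \<and> mball x (2 * e x) \<subseteq> K x"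
    by metis
  have "\<exists>\<F>. finite \<F> \<and> \<F> \<subseteq> (\<lambda>x. mball x (e x)) ` C \<and> C \<subseteq> \<Union>\<F>"
    using eK CM by (intro compactinD[OF C]) auto
  then obtain \<F> where \<F>: "finite \<F>" "\<F> \<subseteq> (\<lambda>x. mball x (e x)) ` C" "C \<subseteq> \<Union>\<F>"
    by blast
  obtain F where F: "finite F" "F \<subseteq> C" "C \<subseteq> (\<Union>x\<in>F. mball x (e x))"
    using finite_subset_image[OF \<F>(1,2)] \<F>(3) by metis
  \<comment> \<open>A further move by at most the smallest radius \<open>\<epsilon>\<close> stays
    inside the doubled ball, hence inside one of finitely many compact sets.\<close>
  have "\<exists>\<epsilon>>0. \<forall>x\<in>F. \<epsilon> \<le> e x"
    by (rule finite_uniform_radius[OF F(1)]) (use eK F(2) in \<open>auto intro: order_refl\<close>)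
  then obtain \<epsilon> where \<epsilon>: "\<epsilon> > 0" "\<And>x. x \<in> F \<Longrightarrow> \<epsilon> \<le> e x"
    by blast
  have "reach g (r + \<epsilon>) \<subseteq> (\<Union>x\<in>F. K x)"
  proof
    fix y assume y: "y \<in> reach g (r + \<epsilon>)"
    then have yM: "y \<in> M" using reach_subset by blast
    obtain x where x: "x \<in> reach g r" "d x y \<le> \<epsilon>"
      using reach_near[OF y \<open>r \<ge> 0\<close>] \<epsilon>(1) by force
    have "x \<in> C"
      using x(1) closure_of_subset[of "reach g r" mtopology] reach_subset by (auto simp: C_def)
    then obtain k where k: "k \<in> F" "x \<in> mball k (e k)"
      using F(3) by blast
    have "d k y \<le> d k x + d x y"
      using k yM by (intro triangle) auto
    then have "y \<in> mball k (2 * e k)"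
      using k x(2) \<epsilon>(2)[OF k(1)] yM by auto
    then show "y \<in> (\<Union>x\<in>F. K x)"
      using k(1) eK F(2) by blast
  qed
  moreover have "compactin mtopology (\<Union>x\<in>F. K x)"
    using F eK by (intro compactin_Union) auto
  ultimately show ?thesis
    using \<epsilon>(1) compactin_imp_mtotally_bounded mtotally_bounded_subset by blast
qed

text \<open>The argument of Hopf and Rinow, for length measured by \<open>d\<close>, with \<open>d\<close> itself not intrinsic.\<close>

lemma mtotally_bounded_reach:
  assumes mc: mcomplete and lc: "locally_compact_space mtopology"
  shows "mtotally_bounded (reach g r)"
proof (rule ccontr)
  assume r: "\<not> mtotally_bounded (reach g r)"
  \<comment> \<open>Consider the infimum of the failing radii. It does not fail itself, by the limit
    lemma, and then the extension lemma moves the good radii past it.\<close>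
  define S where "S = {r. \<not> mtotally_bounded (reach g r)}"
  have pos: "0 < s" if "s \<in> S" for s
    using that mtotally_bounded_reach_0[of g] mtotally_bounded_subset reach_mono[of s 0 g]
    unfolding S_def by (metis linorder_not_le mem_Collect_eq)
  then have bdd: "bdd_below S"
    by (meson bdd_belowI less_imp_le)
  have ne: "S \<noteq> {}" using r by (auto simp: S_def)
  have inf: "0 \<le> Inf S" using pos ne by (meson cInf_greatest less_imp_le)
  have below: "mtotally_bounded (reach g s)" if "s < Inf S" for s
    using that cInf_lower[OF _ bdd, of s] by (auto simp: S_def)
  have "mtotally_bounded (reach g (Inf S))"
    using mtotally_bounded_reach_0 mtotally_bounded_reach_limit[OF _ below] inf
    by (cases "Inf S = 0") auto
  then obtain e where e: "e > 0" "mtotally_bounded (reach g (Inf S + e))"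
    using mtotally_bounded_reach_extend[OF mc lc inf] by blast
  obtain s where "s \<in> S" "s < Inf S + e"
    using cInf_less_iff[OF ne bdd, of "Inf S + e"] e(1) by auto
  then have "mtotally_bounded (reach g s)"
    by (intro mtotally_bounded_subset[OF e(2) reach_mono]) simp
  then show False
    using \<open>s \<in> S\<close> by (simp add: S_def)
qed

lemma continuous_map_dist_compose:
  assumes "continuous_map Y mtopology p" "continuous_map Y mtopology q"
  shows "continuous_map Y euclideanreal (\<lambda>x. d (p x) (q x))"
  using continuous_map_mdist[of Y Self p q] assms by (simp add: mtopology_of_def)

end

section \<open>Limits of short curves\<close>

text \<open>The curves are points of a product of copies of a compact set, one for each time. A
  cluster point is taken, as the index set is uncountable; the required properties are closed
  conditions on finitely many values and pass to it. Shortness after translation by \<open>w\<close>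
  is asked only of late curves, because the sets of words grow with \<open>n\<close>.\<close>

lemma (in translated_metric) short_curve_limit:
  assumes mc: mcomplete and lc: "locally_compact_space mtopology"
    and W: "W \<subseteq> carrier G" and L: "L \<ge> 0"
    and c: "\<And>n. short_curve (carrier G) (\<lambda>x y. ennreal (d x y)) (c n)" and c0: "\<And>n. c n 0 = g"
    and evW: "\<And>w. w \<in> W \<Longrightarrow> \<forall>\<^sub>F n in sequentially.
      short_curve (carrier G) (\<lambda>x y. ennreal (d x y)) (\<lambda>s. c n s \<otimes> w)"
    and lim: "limitin mtopology (\<lambda>n. c n L) y sequentially"
  obtains c' where "\<And>s. c' s \<in> carrier G" "c' 0 = g" "c' L = y"
    "\<And>w. w \<in> W \<Longrightarrow> short_curve (carrier G) (\<lambda>x y. ennreal (d x y)) (\<lambda>s. c' s \<otimes> w)"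
proof -
  \<comment> \<open>Freezing the curves outside [0,L] keeps all their values in
    \<open>reach g L\<close>; since \<open>\<kappa>\<close> is 1-Lipschitz they stay short.\<close>
  define \<kappa> where "\<kappa> s = max 0 (min s L)" for s
  have \<kappa>: "0 \<le> \<kappa> s" "\<kappa> s \<le> L" "\<bar>\<kappa> s - \<kappa> t\<bar> \<le> \<bar>s - t\<bar>" for s t
    using L by (auto simp: \<kappa>_def)
  have \<kappa>0: "\<kappa> 0 = 0" and \<kappa>L: "\<kappa> L = L" using L by (auto simp: \<kappa>_def)
  define C where "C n = (\<lambda>s. c n (\<kappa> s))" for n
  define K where "K = mtopology closure_of (reach g L)"
  have K: "compactin mtopology K"
    using mtotally_bounded_reach[OF mc lc] mtotally_bounded_eq_compact_closure_of[OF mc]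
    unfolding K_def by blast
  have "C n s \<in> reach g L" for n s
    unfolding reach_def C_def using c c0 \<kappa> by blast
  then have CK: "C n s \<in> K" for n s
    using closure_of_subset[of "reach g L" mtopology] reach_subset by (auto simp: K_def)
  define Y where "Y = product_topology (\<lambda>_::real. subtopology mtopology K) UNIV"
  have Y: "compact_space Y"
    unfolding Y_def using K by (simp add: compact_space_product_topology compact_space_subtopology)
  have topY: "topspace Y = {f. \<forall>s. f s \<in> K}"
    using compactin_subset_topspace[OF K] by (auto simp: Y_def PiE_UNIV_domain)
  have CY: "C n \<in> topspace Y" for n
    using CK by (simp add: topY)
  have pr: "continuous_map Y mtopology (\<lambda>f. f s)" for s
    using continuous_map_product_projection[of s UNIV "\<lambda>_. subtopology mtopology K"]
    unfolding Y_def by (simp add: continuous_map_in_subtopology)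
  \<comment> \<open>The closures of the tails are nested and nonempty; a common point is a cluster
    point.\<close>
  have "(\<Inter>n. Y closure_of (C ` {n..})) \<noteq> {}"
  proof (rule compact_space_imp_nest[OF Y])
    show "Y closure_of (C ` {n..}) \<noteq> {}" for n
      using closure_of_subset[of "C ` {n..}" Y] CY by (auto simp: image_subset_iff)
    show "decseq (\<lambda>n. Y closure_of (C ` {n..}))"
      by (intro decseq_SucI closure_of_mono image_mono) auto
  qed auto
  then obtain c' where c': "\<And>n. c' \<in> Y closure_of (C ` {n..})" by blast
  \<comment> \<open>The transfer principle: a bound on a continuous function that holds for late
    curves holds for the cluster point. It is used for both endpoints and for the Lipschitz
    bounds.\<close>
  have closed: "f c' \<le> r"
    if f: "continuous_map Y euclideanreal f" and ev: "\<forall>\<^sub>F n in sequentially. f (C n) \<le> r"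
    for f and r :: real
  proof -
    obtain N where N: "\<And>n. n \<ge> N \<Longrightarrow> f (C n) \<le> r"
      using ev unfolding eventually_sequentially by blast
    have "closedin Y {x \<in> topspace Y. f x \<in> {..r}}"
      by (rule closedin_continuous_map_preimage[OF f]) simp
    moreover have "C ` {N..} \<subseteq> {x \<in> topspace Y. f x \<in> {..r}}"
      using N CY by blast
    ultimately have "Y closure_of (C ` {N..}) \<subseteq> {x \<in> topspace Y. f x \<in> {..r}}"
      by (rule closure_of_minimal[rotated])
    then show ?thesis using c'[of N] by blast
  qed
  have c'K: "c' s \<in> K" for s
    using c'[of 0] in_closure_of topY by fastforce
  then have c'M: "c' s \<in> carrier G" for s
    using compactin_subset_topspace[OF K] by auto
  have gM: "g \<in> carrier G" and yM: "y \<in> carrier G"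
    using c[of 0] c0[of 0] limitin_mspace[OF lim] by (auto simp: short_curve_def)
  have "d (c' 0) g \<le> 0"
    by (rule closed[of "\<lambda>f. d (f 0) g"])
      (use gM in \<open>auto intro!: continuous_map_dist_compose pr simp: C_def \<kappa>0 c0\<close>)
  then have "c' 0 = g"
    using c'M gM by (metis nonneg order_antisym zero)
  have "d (c' L) y \<le> 0"
  proof (rule field_le_epsilon)
    fix e :: real assume "e > 0"
    then have "\<forall>\<^sub>F n in sequentially. c n L \<in> carrier G \<and> d (c n L) y < e"
      using lim by (simp add: limitin_metric)
    then have "\<forall>\<^sub>F n in sequentially. d (C n L) y \<le> e"
      by eventually_elim (simp add: C_def \<kappa>L)
    then have "d (c' L) y \<le> e"
      using yM by (intro closed[of "\<lambda>f. d (f L) y"] continuous_map_dist_compose pr) auto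
    then show "d (c' L) y \<le> 0 + e" by simp
  qed
  then have "c' L = y"
    using c'M yM by (metis nonneg order_antisym zero)
  have "short_curve (carrier G) (\<lambda>x y. ennreal (d x y)) (\<lambda>s. c' s \<otimes> w)" if w: "w \<in> W" for w
    unfolding short_curve_ennreal_iff
  proof (intro conjI allI)
    have wG: "w \<in> carrier G" using w W by blast
    show "c' s \<otimes> w \<in> carrier G" for s using c'M wG by simp
    fix s t
    have tr: "continuous_map Y mtopology (\<lambda>f. f s \<otimes> w)" for s
      using continuous_map_compose[OF pr right_translation_continuous[OF wG]] by (simp add: o_def)
    have "\<forall>\<^sub>F n in sequentially. d (C n s \<otimes> w) (C n t \<otimes> w) \<le> \<bar>s - t\<bar>"
      using evW[OF w] by eventually_elim
        (use \<kappa>(3)[of s t] in \<open>auto simp: short_curve_ennreal_iff C_def intro: order_trans\<close>)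
    then show "d (c' s \<otimes> w) (c' t \<otimes> w) \<le> \<bar>s - t\<bar>"
      by (intro closed[of "\<lambda>f. d (f s \<otimes> w) (f t \<otimes> w)"] continuous_map_dist_compose tr)
  qed
  then show ?thesis
    using that[of c'] c'M \<open>c' 0 = g\<close> \<open>c' L = y\<close> by blast
qed

section \<open>The limit of the induced Hausdorff metrics\<close>

context translated_metric
begin

text \<open>It encodes shortness of all translates at once as shortness for one pseudometric. With
  \<open>dist_seq i\<close> it is compared through short curves, for
  \<open>W = words i\<close>.\<close>

definition translate_sup :: "'a set \<Rightarrow> 'a \<Rightarrow> 'a \<Rightarrow> ennreal"
  where "translate_sup W x y = (SUP w\<in>W. ennreal (d (x \<otimes> w) (y \<otimes> w)))"

lemma ext_pseudometric_on_translate_sup: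
  assumes "W \<subseteq> carrier G"
  shows "ext_pseudometric_on (carrier G) (translate_sup W)"
proof (rule ext_pseudometric_onI)
  fix x y z assume xyz: "x \<in> carrier G" "y \<in> carrier G" "z \<in> carrier G"
  show "translate_sup W x z \<le> translate_sup W x y + translate_sup W y z"
    unfolding translate_sup_def[of W x z]
  proof (rule SUP_least)
    fix w assume w: "w \<in> W"
    have "ennreal (d (x \<otimes> w) (z \<otimes> w)) \<le> ennreal (d (x \<otimes> w) (y \<otimes> w)) + ennreal (d (y \<otimes> w) (z \<otimes> w))"
      using xyz w assms by (intro ext_pseudometric_onD(3)[OF ext_pseudometric_on_ennreal]) auto
    also have "\<dots> \<le> translate_sup W x y + translate_sup W y z"
      unfolding translate_sup_def using w by (intro add_mono SUP_upper)
    finally show "ennreal (d (x \<otimes> w) (z \<otimes> w)) \<le> translate_sup W x y + translate_sup W y z" .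
  qed
next
  fix x assume "x \<in> carrier G"
  then have "translate_sup W x x \<le> 0"
    unfolding translate_sup_def using assms by (intro SUP_least) auto
  then show "translate_sup W x x = 0" by simp
qed (simp add: translate_sup_def commute)

lemma short_curve_translate_sup_iff:
  assumes "W \<subseteq> carrier G"
  shows "short_curve (carrier G) (translate_sup W) c \<longleftrightarrow> (\<forall>s. c s \<in> carrier G) \<and>
    (\<forall>w\<in>W. short_curve (carrier G) (\<lambda>x y. ennreal (d x y)) (\<lambda>s. c s \<otimes> w))"
  using assms by (auto simp: short_curve_def translate_sup_def SUP_le_iff subset_iff)

lemma short_curve_of_translate_sup:
  assumes "short_curve (carrier G) (translate_sup W) c" "\<one> \<in> W" "W \<subseteq> carrier G"
  shows "short_curve (carrier G) (\<lambda>x y. ennreal (d x y)) c"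
proof -
  have "\<And>s. c s \<in> carrier G" "short_curve (carrier G) (\<lambda>x y. ennreal (d x y)) (\<lambda>s. c s \<otimes> \<one>)"
    using assms short_curve_translate_sup_iff by blast+
  then show ?thesis by simp
qed

end

section \<open>Short curves along the sequence\<close>

context translated_metric_set
begin

abbreviation dist_seq :: "nat \<Rightarrow> 'a \<Rightarrow> 'a \<Rightarrow> ennreal"
  where "dist_seq \<equiv> hausdorff_seq G X (\<lambda>x y. ennreal (d x y))"

text \<open>New letters go on the left: \<open>c\<close> is short for
  \<open>dist_seq (Suc i)\<close> iff every \<open>c x\<close> is short for
  \<open>dist_seq i\<close>, that is, iff every \<open>(c x) w\<close> with
  \<open>w \<in> words i\<close> is \<open>d\<close>-short.\<close>

primrec words :: "nat \<Rightarrow> 'a set" where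
  "words 0 = {\<one>}"
| "words (Suc i) = X <#> words i"

lemma words_carrier: "words i \<subseteq> carrier G"
  by (induction i) (use X_subset in \<open>auto simp: set_mult_def\<close>)

lemma words_Suc: "words i \<subseteq> words (Suc i)"
proof
  fix w assume "w \<in> words i"
  then have "\<one> \<otimes> w \<in> words (Suc i)"
    using one_X by (auto simp: set_mult_def)
  moreover have "\<one> \<otimes> w = w"
    using \<open>w \<in> words i\<close> words_carrier by (intro l_one) blast
  ultimately show "w \<in> words (Suc i)"
    by simp
qed

lemma words_mono: "i \<le> j \<Longrightarrow> words i \<subseteq> words j"
  using lift_Suc_mono_le[of words] words_Suc by blast

lemma one_words: "\<one> \<in> words i"
  using words_mono[of 0 i] by auto

text \<open>The claims go through one induction because
  \<open>short_curve_hausdorff_orbit_iff\<close> takes the first two, at stage \<open>i\<close>, to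
  give the third at the next.\<close>

lemma dist_seq_props:
  "ext_pseudometric_on (carrier G) (dist_seq i) \<and>
   (\<forall>a\<in>carrier G. \<forall>b\<in>carrier G. ennreal (d a b) \<le> dist_seq i a b) \<and>
   (\<forall>c. short_curve (carrier G) (dist_seq i) c \<longleftrightarrow>
      short_curve (carrier G) (translate_sup (words i)) c)"
proof (induction i)
  case 0
  have "short_curve (carrier G) (\<lambda>x y. ennreal (d x y)) c \<longleftrightarrow>
      short_curve (carrier G) (translate_sup (words 0)) c" for c
  proof (cases "\<forall>s. c s \<in> carrier G")
    case True
    then have "(\<lambda>s. c s \<otimes> \<one>) = c" by auto
    then show ?thesis
      using True unfolding short_curve_translate_sup_iff[OF words_carrier] by simp
  next
    case False
    then show ?thesis by (auto simp: short_curve_def)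
  qed
  then show ?case
    using ext_pseudometric_on_ennreal by simp
next
  case (Suc i)
  let ?\<sigma> = "hausdorff_orbit G X (dist_seq i)"
  have IH: "ext_pseudometric_on (carrier G) (dist_seq i)"
    "\<And>a b. a \<in> carrier G \<Longrightarrow> b \<in> carrier G \<Longrightarrow> ennreal (d a b) \<le> dist_seq i a b"
    "\<And>c. short_curve (carrier G) (dist_seq i) c \<longleftrightarrow>
      short_curve (carrier G) (translate_sup (words i)) c"
    using Suc by blast+
  have ps: "ext_pseudometric_on (carrier G) ?\<sigma>"
    by (rule ext_pseudometric_on_hausdorff_orbit[OF IH(1)])
  have iff: "short_curve (carrier G) (dist_seq (Suc i)) c \<longleftrightarrow>
      short_curve (carrier G) (translate_sup (words (Suc i))) c" for c
  proof -
    let ?d = "\<lambda>x y. ennreal (d x y)"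
    have "short_curve (carrier G) (dist_seq (Suc i)) c \<longleftrightarrow> (\<forall>s. c s \<in> carrier G) \<and>
        (\<forall>x\<in>X. short_curve (carrier G) (dist_seq i) (\<lambda>s. c s \<otimes> x))"
      by (simp only: hausdorff_seq.simps short_curve_induced_intrinsic_iff[OF ps]
          short_curve_hausdorff_orbit_iff[OF IH(1,2)])
    also have "\<dots> \<longleftrightarrow> (\<forall>s. c s \<in> carrier G) \<and>
        (\<forall>x\<in>X. \<forall>w\<in>words i. short_curve (carrier G) ?d (\<lambda>s. c s \<otimes> x \<otimes> w))"
      unfolding IH(3) short_curve_translate_sup_iff[OF words_carrier] using X_carrier by blast
    also have "\<dots> \<longleftrightarrow> (\<forall>s. c s \<in> carrier G) \<and>
        (\<forall>x\<in>X. \<forall>w\<in>words i. short_curve (carrier G) ?d (\<lambda>s. c s \<otimes> (x \<otimes> w)))"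
    proof (intro conj_cong refl ball_cong)
      fix x w assume *: "\<forall>s. c s \<in> carrier G" "x \<in> X" "w \<in> words i"
      then have "(\<lambda>s. c s \<otimes> x \<otimes> w) = (\<lambda>s. c s \<otimes> (x \<otimes> w))"
        using words_carrier by (intro ext m_assoc) auto
      then show "short_curve (carrier G) ?d (\<lambda>s. c s \<otimes> x \<otimes> w) \<longleftrightarrow>
          short_curve (carrier G) ?d (\<lambda>s. c s \<otimes> (x \<otimes> w))"
        by simp
    qed
    also have "\<dots> \<longleftrightarrow> short_curve (carrier G) (translate_sup (words (Suc i))) c"
      unfolding short_curve_translate_sup_iff[OF words_carrier] by (auto simp: set_mult_def)
    finally show ?thesis .
  qed
  have ps': "ext_pseudometric_on (carrier G) (dist_seq (Suc i))"
    using ext_pseudometric_on_induced_intrinsic[OF ps] by simp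
  \<comment> \<open>The orbit metric may fall below \<open>d\<close>, since its matchings can
    permute \<open>X\<close>. Its intrinsic metric does not: \<open>\<one>\<close> is a word, so its
    short curves are \<open>d\<close>-short.\<close>
  have "ennreal (d a b) \<le> dist_seq (Suc i) a b" for a b
  proof (rule ennreal_le_of_less_real)
    fix L :: real assume L: "L > 0" "dist_seq (Suc i) a b < ennreal L"
    then obtain c where c: "short_curve (carrier G) ?\<sigma> c" "c 0 = a" "c L = b"
      using induced_intrinsic_less_imp_short_curve[OF ps, of a b L] by auto
    then have "short_curve (carrier G) (translate_sup (words (Suc i))) c"
      using iff short_curve_induced_intrinsic_iff[OF ps] by simp
    then have "short_curve (carrier G) (\<lambda>x y. ennreal (d x y)) c"
      using one_words words_carrier by (rule short_curve_of_translate_sup)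
    from short_curve_dist_le[OF this c(2,3)] L(1) show "ennreal (d a b) \<le> ennreal L"
      by simp
  qed
  then show ?case using ps' iff by blast
qed

lemmas ext_pseudometric_on_dist_seq = dist_seq_props[THEN conjunct1]
lemmas short_curve_dist_seq_iff = dist_seq_props[THEN conjunct2, THEN conjunct2, THEN spec]

text \<open>Stated from index 1 on, since \<open>dist_seq 0\<close> is \<open>d\<close>, which need
  not be intrinsic.\<close>

lemma dist_seq_Suc_less_imp_short_curve:
  assumes "dist_seq (Suc i) x y < ennreal L"
  shows "\<exists>c. short_curve (carrier G) (translate_sup (words (Suc i))) c \<and> c 0 = x \<and> c L = y"
proof -
  have ps: "ext_pseudometric_on (carrier G) (hausdorff_orbit G X (dist_seq i))"
    using ext_pseudometric_on_hausdorff_orbit[OF ext_pseudometric_on_dist_seq] .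
  obtain c where c: "short_curve (carrier G) (hausdorff_orbit G X (dist_seq i)) c" "c 0 = x" "c L = y"
    using induced_intrinsic_less_imp_short_curve[OF ps, of x y L] assms by auto
  then have "short_curve (carrier G) (dist_seq (Suc i)) c"
    using short_curve_induced_intrinsic_iff[OF ps] by simp
  then show ?thesis
    using c short_curve_dist_seq_iff by blast
qed

lemma short_curve_translate_sup_subset:
  assumes "short_curve (carrier G) (translate_sup W) c" "W' \<subseteq> W" "W \<subseteq> carrier G"
  shows "short_curve (carrier G) (translate_sup W') c"
  using assms(1,2)
  unfolding short_curve_translate_sup_iff[OF assms(3)]
    short_curve_translate_sup_iff[OF order_trans[OF assms(2,3)]]
  by blast

text \<open>More words impose more conditions, so fewer curves are short and distances grow.\<close>

lemma incseq_dist_seq: "incseq (\<lambda>i. dist_seq i x y)"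
proof (rule incseq_SucI)
  fix i
  show "dist_seq i x y \<le> dist_seq (Suc i) x y"
  proof (rule ennreal_le_of_less_real)
    fix L :: real assume L: "L > 0" "dist_seq (Suc i) x y < ennreal L"
    obtain c where c: "short_curve (carrier G) (translate_sup (words (Suc i))) c" "c 0 = x" "c L = y"
      using dist_seq_Suc_less_imp_short_curve[OF L(2)] by blast
    then have "short_curve (carrier G) (dist_seq i) c"
      using short_curve_dist_seq_iff short_curve_translate_sup_subset[OF c(1) words_Suc words_carrier]
      by blast
    from short_curve_dist_le[OF this c(2,3)] L(1) show "dist_seq i x y \<le> ennreal L"
      by simp
  qed
qed

section \<open>The limit metric and pointwise convergence\<close>

text \<open>The submonoid generated by \<open>X\<close>.\<close>

definition all_words :: "'a set"
  where "all_words = (\<Union>i. words i)"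

text \<open>Defined through its short curves instead of as a limit, so that the general lemmas on
  induced intrinsic metrics apply to it.\<close>

definition dist_limit :: "'a \<Rightarrow> 'a \<Rightarrow> ennreal"
  where "dist_limit = induced_intrinsic (carrier G) (translate_sup all_words)"

lemma all_words_carrier: "all_words \<subseteq> carrier G"
  using words_carrier by (auto simp: all_words_def)

lemma ext_pseudometric_on_dist_limit: "ext_pseudometric_on (carrier G) dist_limit"
  unfolding dist_limit_def
  by (intro ext_pseudometric_on_induced_intrinsic ext_pseudometric_on_translate_sup all_words_carrier)

lemma short_curve_dist_limit_iff:
  "short_curve (carrier G) dist_limit c \<longleftrightarrow> short_curve (carrier G) (translate_sup all_words) c"
  unfolding dist_limit_def
  by (intro short_curve_induced_intrinsic_iff ext_pseudometric_on_translate_sup all_words_carrier)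

lemma dist_limit_less_imp_short_curve:
  assumes "dist_limit x y < ennreal L"
  shows "\<exists>c. short_curve (carrier G) (translate_sup all_words) c \<and> c 0 = x \<and> c L = y"
  using assms unfolding dist_limit_def
  by (rule induced_intrinsic_less_imp_short_curve
      [OF ext_pseudometric_on_translate_sup[OF all_words_carrier]])

lemma dist_limit_le:
  assumes "short_curve (carrier G) (translate_sup all_words) c" "c 0 = x" "c L = y" "L \<ge> 0"
  shows "dist_limit x y \<le> ennreal L"
  using short_curve_dist_le[of "carrier G" dist_limit c x L y] assms
  by (simp add: short_curve_dist_limit_iff)

lemma dist_seq_le_dist_limit: "dist_seq i x y \<le> dist_limit x y"
proof (rule ennreal_le_of_less_real)
  fix L :: real assume L: "L > 0" "dist_limit x y < ennreal L"
  obtain c where c: "short_curve (carrier G) (translate_sup all_words) c" "c 0 = x" "c L = y"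
    using dist_limit_less_imp_short_curve[OF L(2)] by blast
  have "words i \<subseteq> all_words" by (auto simp: all_words_def)
  then have "short_curve (carrier G) (dist_seq i) c"
    using short_curve_dist_seq_iff short_curve_translate_sup_subset[OF c(1) _ all_words_carrier]
    by blast
  from short_curve_dist_le[OF this c(2,3)] L(1) show "dist_seq i x y \<le> ennreal L"
    by simp
qed

lemma dist_le_dist_limit: "ennreal (d x y) \<le> dist_limit x y"
  using dist_seq_le_dist_limit[of 0 x y] by simp

text \<open>Each word lies in \<open>words n\<close> for all large \<open>n\<close>, so a limit
  curve is short for all words. Used with a fixed endpoint for the convergence and with moving
  endpoints for the completeness.\<close>

lemma dist_limit_le_of_short_curves:
  assumes mc: mcomplete and lc: "locally_compact_space mtopology" and L: "L \<ge> 0"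
    and c: "\<And>n. short_curve (carrier G) (translate_sup (words n)) (c n)" and c0: "\<And>n. c n 0 = x"
    and lim: "limitin mtopology (\<lambda>n. c n L) y sequentially"
  shows "dist_limit x y \<le> ennreal L"
proof -
  let ?d = "\<lambda>x y. ennreal (d x y)"
  have 1: "short_curve (carrier G) ?d (c n)" for n
    using short_curve_of_translate_sup[OF c one_words words_carrier] .
  have 2: "\<forall>\<^sub>F n in sequentially. short_curve (carrier G) ?d (\<lambda>s. c n s \<otimes> w)" if w: "w \<in> all_words" for w
  proof -
    obtain j where "w \<in> words j" using w by (auto simp: all_words_def)
    then have "short_curve (carrier G) ?d (\<lambda>s. c n s \<otimes> w)" if "n \<ge> j" for n
      using c[of n] short_curve_translate_sup_iff[OF words_carrier] words_mono[OF that] by blast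
    then show ?thesis unfolding eventually_sequentially by blast
  qed
  obtain c' where c': "\<And>s. c' s \<in> carrier G" "c' 0 = x" "c' L = y"
    "\<And>w. w \<in> all_words \<Longrightarrow> short_curve (carrier G) ?d (\<lambda>s. c' s \<otimes> w)"
    using short_curve_limit[OF mc lc all_words_carrier L 1 c0 2 lim] by blast
  then have "short_curve (carrier G) (translate_sup all_words) c'"
    using short_curve_translate_sup_iff[OF all_words_carrier] by blast
  from dist_limit_le[OF this c'(2,3) L] show ?thesis .
qed

text \<open>The sequence increases, so only its supremum matters. Any \<open>L\<close> above the
  supremum gives a curve of the same duration \<open>L\<close> at every stage, and the compactness
  lemma provides a limit curve.\<close>

lemma dist_seq_tendsto:
  assumes mc: mcomplete and lc: "locally_compact_space mtopology" and y: "y \<in> carrier G"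
  shows "(\<lambda>i. dist_seq i x y) \<longlonglongrightarrow> dist_limit x y"
proof -
  have "dist_limit x y \<le> (SUP i. dist_seq i x y)"
  proof (rule ennreal_le_of_less_real)
    fix L :: real assume L: "L > 0" "(SUP i. dist_seq i x y) < ennreal L"
    have "\<exists>c. short_curve (carrier G) (translate_sup (words n)) c \<and> c 0 = x \<and> c L = y" for n
    proof -
      have "dist_seq (Suc n) x y < ennreal L"
        using L(2) by (meson SUP_upper UNIV_I order_le_less_trans)
      then obtain c where "short_curve (carrier G) (translate_sup (words (Suc n))) c" "c 0 = x" "c L = y"
        using dist_seq_Suc_less_imp_short_curve by blast
      then show ?thesis
        using short_curve_translate_sup_subset[OF _ words_Suc words_carrier] by blast
    qed
    then obtain c where c: "\<And>n. short_curve (carrier G) (translate_sup (words n)) (c n)"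
      "\<And>n. c n 0 = x" "\<And>n. c n L = y" by metis
    then show "dist_limit x y \<le> ennreal L"
      using L(1) y by (intro dist_limit_le_of_short_curves[OF mc lc, of L c]) auto
  qed
  moreover have "(SUP i. dist_seq i x y) \<le> dist_limit x y"
    by (intro SUP_least dist_seq_le_dist_limit)
  ultimately show ?thesis
    using LIMSEQ_SUP[OF incseq_dist_seq, of x y] by (simp add: order_antisym)
qed

section \<open>Finiteness, completeness and intrinsicness of the limit\<close>

text \<open>Right translates of a \<open>D\<close>-short curve are again \<open>D\<close>-short,
  hence \<open>d\<close>-short, whatever the word.\<close>

lemma dist_limit_le_right_invariant:
  assumes D: "Metric_space (carrier G) D" and intr: "is_intrinsic (carrier G) (\<lambda>x y. ennreal (D x y))"
    and inv: "right_invariant G D" and le: "\<forall>x\<in>carrier G. \<forall>y\<in>carrier G. d x y \<le> D x y"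
    and xy: "x \<in> carrier G" "y \<in> carrier G"
  shows "dist_limit x y \<le> ennreal (D x y)"
proof (rule ennreal_le_of_less_real)
  interpret D: Metric_space "carrier G" D by (fact D)
  fix L :: real assume L: "L > 0" "ennreal (D x y) < ennreal L"
  then have "induced_intrinsic (carrier G) (\<lambda>x y. ennreal (D x y)) x y < ennreal L"
    using intr xy by (simp add: is_intrinsic_def)
  then obtain c where c: "short_curve (carrier G) (\<lambda>x y. ennreal (D x y)) c" "c 0 = x" "c L = y"
    using induced_intrinsic_less_imp_short_curve[OF D.ext_pseudometric_on_ennreal] by blast
  then have cM: "\<And>s. c s \<in> carrier G" and cD: "\<And>s t. D (c s) (c t) \<le> \<bar>s - t\<bar>"
    by (auto simp: D.short_curve_ennreal_iff)
  have "d (c s \<otimes> w) (c t \<otimes> w) \<le> \<bar>s - t\<bar>" if "w \<in> carrier G" for s t w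
  proof -
    have "d (c s \<otimes> w) (c t \<otimes> w) \<le> D (c s \<otimes> w) (c t \<otimes> w)"
      using le cM that by simp
    also have "\<dots> = D (c s) (c t)"
      using inv cM that by (simp add: right_invariant_def)
    finally show ?thesis using cD order_trans by blast
  qed
  then have "short_curve (carrier G) (translate_sup all_words) c"
    unfolding short_curve_translate_sup_iff[OF all_words_carrier] short_curve_ennreal_iff
    using cM all_words_carrier by auto
  from dist_limit_le[OF this c(2,3)] L(1) show "dist_limit x y \<le> ennreal L"
    by simp
qed

text \<open>\<open>Metric_space\<close> asks for symmetry and nonnegativity at all arguments, hence
  the value 0 off the carrier.\<close>

definition dist_limit_real :: "'a \<Rightarrow> 'a \<Rightarrow> real"
  where "dist_limit_real x y =
    (if x \<in> carrier G \<and> y \<in> carrier G then enn2real (dist_limit x y) else 0)"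

lemma dist_limit_real_metric:
  assumes mc: mcomplete and lc: "locally_compact_space mtopology"
    and fin: "\<And>x y. x \<in> carrier G \<Longrightarrow> y \<in> carrier G \<Longrightarrow> dist_limit x y < \<infinity>"
  shows "Metric_space (carrier G) dist_limit_real"
    and "Metric_space.mcomplete (carrier G) dist_limit_real"
    and "is_intrinsic (carrier G) (\<lambda>x y. ennreal (dist_limit_real x y))"
    and "\<And>x y. x \<in> carrier G \<Longrightarrow> y \<in> carrier G \<Longrightarrow> ennreal (dist_limit_real x y) = dist_limit x y"
proof -
  let ?M = "carrier G" and ?e = "dist_limit_real"
  note ps = ext_pseudometric_onD[OF ext_pseudometric_on_dist_limit]
  show real: "ennreal (?e x y) = dist_limit x y" if "x \<in> ?M" "y \<in> ?M" for x y
    using fin[OF that] that by (simp add: dist_limit_real_def)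
  have nn: "?e x y \<ge> 0" for x y
    by (simp add: dist_limit_real_def)
  have d_le: "d x y \<le> ?e x y" if "x \<in> ?M" "y \<in> ?M" for x y
    using dist_le_dist_limit[of x y] real[OF that] nn[of x y] by (metis ennreal_le_iff)
  show E: "Metric_space ?M ?e"
  proof
    show "?e x y = ?e y x" for x y
      using ps(2)[of x y] by (auto simp: dist_limit_real_def)
    show "?e x y = 0 \<longleftrightarrow> x = y" if "x \<in> ?M" "y \<in> ?M" for x y
    proof
      assume "?e x y = 0"
      then show "x = y" using d_le[OF that] that by (metis nonneg order_antisym zero)
    next
      assume "x = y"
      then show "?e x y = 0" using ps(1) that by (simp add: dist_limit_real_def)
    qed
    show "?e x z \<le> ?e x y + ?e y z" if "x \<in> ?M" "y \<in> ?M" "z \<in> ?M" for x y z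
    proof -
      have "ennreal (?e x z) \<le> ennreal (?e x y) + ennreal (?e y z)"
        using ps(3)[OF that] that by (simp only: real)
      then show ?thesis using nn by (simp flip: ennreal_plus)
    qed
  qed (rule nn)
  then interpret E: Metric_space ?M ?e .
  show "E.mcomplete"
    unfolding E.mcomplete_def
  proof (intro allI impI)
    fix u assume u: "E.MCauchy u"
    then have "range u \<subseteq> ?M"
      unfolding E.MCauchy_def by (rule conjunct1)
    then have uM: "u n \<in> ?M" for n
      by (rule subsetD) (rule rangeI)
    \<comment> \<open>As \<open>d\<close> is the smaller metric, the sequence has a
      \<open>d\<close>-limit; it remains to see that it converges there in the larger metric as
      well.\<close>
    have "MCauchy u"
      unfolding MCauchy_def
    proof (intro conjI allI impI)
      show "range u \<subseteq> ?M" by fact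
      fix e :: real assume "e > 0"
      then obtain N where "\<And>n n'. N \<le> n \<Longrightarrow> N \<le> n' \<Longrightarrow> ?e (u n) (u n') < e"
        using u unfolding E.MCauchy_def by blast
      then have "d (u n) (u n') < e" if "N \<le> n" "N \<le> n'" for n n'
        using that d_le[OF uM uM, of n n'] order_le_less_trans by blast
      then show "\<exists>N. \<forall>n n'. N \<le> n \<longrightarrow> N \<le> n' \<longrightarrow> d (u n) (u n') < e"
        by blast
    qed
    then obtain x where x: "limitin mtopology u x sequentially"
      using mc unfolding mcomplete_def by blast
    then have xM: "x \<in> ?M" using limitin_mspace by blast
    have "limitin E.mtopology u x sequentially"
      unfolding E.limitin_metric
    proof (intro conjI allI impI)
      fix e :: real assume e: "e > 0"
      then obtain N where N: "\<And>n n'. N \<le> n \<Longrightarrow> N \<le> n' \<Longrightarrow> ?e (u n) (u n') < e / 2"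
        using u unfolding E.MCauchy_def by (meson half_gt_zero)
      have "?e (u n) x < e" if n: "n \<ge> N" for n
      proof -
        \<comment> \<open>Curves of common duration \<open>e / 2\<close> lead from
          \<open>u n\<close> to all later terms, whose \<open>d\<close>-limit is \<open>x\<close>; a
          limit curve then leads to \<open>x\<close>. The shift by \<open>N\<close> starts where the
          Cauchy bound applies, and \<open>e / 2\<close> leaves room for the strict
          inequality.\<close>
        have "\<exists>c. short_curve ?M (translate_sup all_words) c \<and> c 0 = u n \<and> c (e / 2) = u (k + N)" for k
        proof -
          have "ennreal (?e (u n) (u (k + N))) < ennreal (e / 2)"
            using N[OF n, of "k + N"] nn by (simp add: ennreal_less_iff)
          then have "dist_limit (u n) (u (k + N)) < ennreal (e / 2)"
            by (simp only: real[OF uM uM])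
          then show ?thesis by (rule dist_limit_less_imp_short_curve)
        qed
        then obtain c where c: "\<And>k. short_curve ?M (translate_sup all_words) (c k)"
          "\<And>k. c k 0 = u n" "\<And>k. c k (e / 2) = u (k + N)" by metis
        have "dist_limit (u n) x \<le> ennreal (e / 2)"
        proof (rule dist_limit_le_of_short_curves[OF mc lc, of "e / 2" c])
          show "short_curve ?M (translate_sup (words k)) (c k)" for k
            using short_curve_translate_sup_subset[OF c(1) _ all_words_carrier]
            by (auto simp: all_words_def)
          show "limitin mtopology (\<lambda>k. c k (e / 2)) x sequentially"
            using limitin_sequentially_offset[OF x, of N] by (simp add: c)
        qed (use e c in auto)
        then have "ennreal (?e (u n) x) \<le> ennreal (e / 2)"
          by (simp only: real[OF uM xM])
        then have "?e (u n) x \<le> e / 2"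
          using e by (simp add: ennreal_le_iff)
        then show ?thesis using e by simp
      qed
      then show "\<forall>\<^sub>F n in sequentially. u n \<in> ?M \<and> ?e (u n) x < e"
        using uM unfolding eventually_sequentially by blast
    qed (rule xM)
    then show "\<exists>x. limitin E.mtopology u x sequentially" by blast
  qed
  show "is_intrinsic ?M (\<lambda>x y. ennreal (?e x y))"
    unfolding is_intrinsic_def
  proof (intro ballI order_antisym)
    fix x y assume xy: "x \<in> ?M" "y \<in> ?M"
    let ?\<sigma> = "\<lambda>x y. ennreal (?e x y)"
    show "?\<sigma> x y \<le> induced_intrinsic ?M ?\<sigma> x y"
      by (rule le_induced_intrinsic[OF E.ext_pseudometric_on_ennreal])
    show "induced_intrinsic ?M ?\<sigma> x y \<le> ?\<sigma> x y"
    proof (rule ennreal_le_of_less_real)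
      fix L :: real assume L: "L > 0" "?\<sigma> x y < ennreal L"
      then have "dist_limit x y < ennreal L" by (simp only: real[OF xy])
      then obtain c where c: "short_curve ?M (translate_sup all_words) c" "c 0 = x" "c L = y"
        using dist_limit_less_imp_short_curve by blast
      then have "short_curve ?M ?\<sigma> c"
        using short_curve_dist_limit_iff[of c] real by (simp add: short_curve_def)
      then show "induced_intrinsic ?M ?\<sigma> x y \<le> ennreal L"
        using induced_intrinsic_le_short_curve[of ?M ?\<sigma> c 0 L] c L by simp
    qed
  qed
qed

end

section \<open>Local compactness of manifolds and the conclusion\<close>

lemma locally_compact_smooth_manifold:
  assumes "smooth_manifold T n A"
  shows "locally_compact_space T"
  unfolding locally_compact_space_def
proof
  fix x assume "x \<in> topspace T"
  moreover have atlas: "\<forall>c\<in>A. is_chart T n c" "(\<Union>(U, \<phi>)\<in>A. U) = topspace T"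
    using assms by (auto simp: smooth_manifold_def smooth_atlas_def)
  ultimately obtain U \<phi> where U: "(U, \<phi>) \<in> A" "x \<in> U"
    by blast
  then have ch: "openin T U" "openin (Euclidean_space n) (\<phi> ` U)"
    "homeomorphic_map (subtopology T U) (subtopology (Euclidean_space n) (\<phi> ` U)) \<phi>"
    using atlas(1) by (auto simp: is_chart_def)
  have "locally_compact_space (subtopology (Euclidean_space n) (\<phi> ` U))"
    using ch(2) Hausdorff_Euclidean_space locally_compact_Euclidean_space
      locally_compact_space_open_subset by blast
  then have "locally_compact_space (subtopology T U)"
    using homeomorphic_locally_compact_space homeomorphic_map_imp_homeomorphic_space[OF ch(3)] by blast
  moreover have "x \<in> topspace (subtopology T U)"
    using U(2) openin_subset[OF ch(1)] by auto
  ultimately obtain V K where VK: "openin (subtopology T U) V" "compactin (subtopology T U) K"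
    "x \<in> V" "V \<subseteq> K"
    unfolding locally_compact_space_def by blast
  then have "openin T V" "compactin T K"
    using openin_open_subtopology[OF ch(1)] compactin_subtopology by blast+
  then show "\<exists>U K. openin T U \<and> compactin T K \<and> x \<in> U \<and> U \<subseteq> K"
    using VK by blast
qed

theorem theorem3p15:
  fixes G :: "('a, 'b) monoid_scheme"
    and T :: "'a topology" and n :: nat and A :: "'a chart set"
    and d :: "'a \<Rightarrow> 'a \<Rightarrow> real" and X :: "'a set"
  assumes "lie_group G T n A"
    and "Metric_space (carrier G) d"
    and "Metric_space.mcomplete (carrier G) d"
    and "Metric_space.mtopology (carrier G) d = T"
    and "finite X" and "X \<subseteq> carrier G" and "\<one>\<^bsub>G\<^esub> \<in> X"
    and "set_stabilizer G X = {\<one>\<^bsub>G\<^esub>}"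
    and "\<exists>D :: 'a \<Rightarrow> 'a \<Rightarrow> real. Metric_space (carrier G) D \<and>
           is_intrinsic (carrier G) (\<lambda>x y. ennreal (D x y)) \<and> right_invariant G D \<and>
           (\<forall>x\<in>carrier G. \<forall>y\<in>carrier G. d x y \<le> D x y)"
  shows "\<exists>dinf :: 'a \<Rightarrow> 'a \<Rightarrow> real. Metric_space (carrier G) dinf \<and>
           Metric_space.mcomplete (carrier G) dinf \<and>
           is_intrinsic (carrier G) (\<lambda>x y. ennreal (dinf x y)) \<and>
           (\<forall>x\<in>carrier G. \<forall>y\<in>carrier G.
              (\<lambda>i. hausdorff_seq G X (\<lambda>x y. ennreal (d x y)) i x y) \<longlonglongrightarrow> ennreal (dinf x y))"
proof -
  have lie: "group G" "topspace T = carrier G" "smooth_manifold T n A"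
    and mult: "continuous_map (prod_topology T T) T (\<lambda>(x, y). x \<otimes>\<^bsub>G\<^esub> y)"
    using assms(1) by (auto simp: lie_group_def smooth_map_def)
  \<comment> \<open>Multiplication with its second factor frozen.\<close>
  have trans: "continuous_map T T (\<lambda>x. x \<otimes>\<^bsub>G\<^esub> w)" if "w \<in> carrier G" for w
  proof -
    have "continuous_map T (prod_topology T T) (\<lambda>x. (x, w))"
      using that lie(2) by (simp add: continuous_map_paired)
    from continuous_map_compose[OF this mult] show ?thesis by (simp add: o_def)
  qed
  interpret group G by (rule lie(1))
  interpret Metric_space "carrier G" d by (rule assms(2))
  interpret translated_metric_set G d X
  proof unfold_locales
    show "continuous_map mtopology mtopology (\<lambda>x. x \<otimes>\<^bsub>G\<^esub> w)" if "w \<in> carrier G" for w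
      unfolding assms(4) using that by (rule trans)
  qed (rule assms)+
  have lc: "locally_compact_space mtopology"
    using locally_compact_smooth_manifold[OF lie(3)] assms(4) by simp
  obtain D where D: "Metric_space (carrier G) D"
    "is_intrinsic (carrier G) (\<lambda>x y. ennreal (D x y))" "right_invariant G D"
    "\<forall>x\<in>carrier G. \<forall>y\<in>carrier G. d x y \<le> D x y"
    using assms(9) by blast
  \<comment> \<open>The right invariant metric makes the limit finite.\<close>
  have "dist_limit x y < \<infinity>" if "x \<in> carrier G" "y \<in> carrier G" for x y
    using order_le_less_trans[OF dist_limit_le_right_invariant[OF D that] ennreal_less_top] by simp
  note lim = dist_limit_real_metric[OF assms(3) lc this]
  show ?thesis
    using lim(1,2,3) dist_seq_tendsto[OF assms(3) lc]
    by (intro exI[of _ dist_limit_real]) (simp add: lim(4))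
qed

end
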